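(* For $1\le p<\infty$ and $\sigma>0$, $\mathsf W_p^{(\sigma)}$ is a metric on $\mathcal P_p(\mathbb R^d)$ inducing the same topology as $\mathsf W_p$.
   Context: $\mathcal P_p(\mathbb R^d)$: Borel probability measures on $\mathbb R^d$ with finite $p$-th absolute moment. $\mathsf W_p(\mu,\nu)=\inf_{\pi\in\Pi(\mu,\nu)}[\int\|x-y\|^pd\pi]^{1/p}$, $\Pi(\mu,\nu)$ the set of couplings. Smoothing kernel: $\chi\in C^\infty(\mathbb R^d)$ is nonnegative, compactly supported, with $\int\chi=1$; for $\sigma>0$, $\chi_\sigma=\sigma^{-d}\chi(\cdot/\sigma)$, and $\eta_\sigma$ is the probability measure with Lebesgue density $\chi_\sigma$. $\mathsf W_p^{(\sigma)}(\mu,\nu)=\mathsf W_p(\mu*\eta_\sigma,\nu*\eta_\sigma)$. *)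

theory Defs
  imports "HOL-Probability.Probability"
begin

definition finite_moment_measures :: "real \<Rightarrow> ('a::euclidean_space) measure set"
  where "finite_moment_measures p =
    {\<mu>. prob_space \<mu> \<and> sets \<mu> = sets borel \<and> integrable \<mu> (\<lambda>x. norm x powr p)}"

definition couplings :: "('a::euclidean_space) measure \<Rightarrow> 'a measure \<Rightarrow> ('a \<times> 'a) measure set"
  where "couplings \<mu> \<nu> =
    {\<pi>. prob_space \<pi> \<and> sets \<pi> = sets (borel \<Otimes>\<^sub>M borel) \<and>
        distr \<pi> borel fst = \<mu> \<and> distr \<pi> borel snd = \<nu>}"

text \<open>Power with a positive real exponent on the extended half-line, so that infinite
  transport costs stay infinite.\<close>

definition ennreal_powr :: "ennreal \<Rightarrow> real \<Rightarrow> ennreal"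
  where "ennreal_powr x r = (if x = \<top> then \<top> else ennreal (enn2real x powr r))"

definition wasserstein ::
    "real \<Rightarrow> ('a::euclidean_space) measure \<Rightarrow> 'a measure \<Rightarrow> ennreal"
  where "wasserstein p \<mu> \<nu> =
    (INF \<pi>\<in>couplings \<mu> \<nu>.
      ennreal_powr (\<integral>\<^sup>+ (x, y). ennreal (norm (x - y) powr p) \<partial>\<pi>) (1 / p))"

text \<open>In finite dimension, \<open>C_k k f\<close> says that \<open>f\<close> is \<open>k\<close> times continuously
  differentiable on the whole space: \<open>frechet_derivative f (at x) v\<close> is the derivative of
  \<open>f\<close> at \<open>x\<close> in direction \<open>v\<close>.\<close>

primrec C_k :: "nat \<Rightarrow> ('a::euclidean_space \<Rightarrow> real) \<Rightarrow> bool"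
  where
    "C_k 0 f \<longleftrightarrow> continuous_on UNIV f"
  | "C_k (Suc k) f \<longleftrightarrow>
      (\<forall>x. f differentiable (at x)) \<and> (\<forall>v. C_k k (\<lambda>x. frechet_derivative f (at x) v))"

definition C_infinity :: "('a::euclidean_space \<Rightarrow> real) \<Rightarrow> bool"
  where "C_infinity f \<longleftrightarrow> (\<forall>k. C_k k f)"

definition smoothing_kernel :: "('a::euclidean_space \<Rightarrow> real) \<Rightarrow> bool"
  where "smoothing_kernel \<kappa> \<longleftrightarrow>
    C_infinity \<kappa> \<and> (\<forall>x. 0 \<le> \<kappa> x) \<and> compact (closure {x. \<kappa> x \<noteq> 0}) \<and>
    (\<integral>x. \<kappa> x \<partial>lborel) = 1"

definition rescaled_kernel ::
    "('a::euclidean_space \<Rightarrow> real) \<Rightarrow> real \<Rightarrow> 'a \<Rightarrow> real"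
  where "rescaled_kernel \<kappa> \<sigma> x = \<kappa> (x /\<^sub>R \<sigma>) / \<sigma> ^ DIM('a)"

definition kernel_measure ::
    "('a::euclidean_space \<Rightarrow> real) \<Rightarrow> real \<Rightarrow> 'a measure"
  where "kernel_measure \<kappa> \<sigma> = density lborel (\<lambda>x. ennreal (rescaled_kernel \<kappa> \<sigma> x))"

definition smooth_wasserstein ::
    "('a::ordered_euclidean_space \<Rightarrow> real) \<Rightarrow> real \<Rightarrow> real \<Rightarrow> 'a measure \<Rightarrow> 'a measure \<Rightarrow> ennreal"
  where "smooth_wasserstein \<kappa> \<sigma> p \<mu> \<nu> =
    wasserstein p (\<mu> \<star> kernel_measure \<kappa> \<sigma>) (\<nu> \<star> kernel_measure \<kappa> \<sigma>)"

end

theory Submission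
  imports Defs "HOL-Complex_Analysis.Complex_Analysis"
begin

text \<open>Throughout, \<open>\<eta>\<close> is the law of the smoothing noise, a compactly supported measure. Adding the same
independent noise to both ends of a coupling does not change their difference, so smoothing can only
decrease \<open>W\<^sub>p\<close> (\<open>wasserstein_convolution_le\<close>). The substance is the converse: near a fixed \<open>\<mu>\<close>, a small
smoothed distance forces a small distance (\<open>wasserstein_small_of_smoothed_small\<close>). Applied to a pair at
smoothed distance zero, this also shows that such a pair coincides; symmetry, finiteness and the
triangle inequality are inherited from \<open>W\<^sub>p\<close>.

For the converse, suppose that \<open>W\<^sub>p(\<nu>\<^sub>n * \<eta>, \<mu> * \<eta>)\<close> tends to 0. Two consequences survive the removal of
\<open>\<eta>\<close>. The first is uniform smallness of tails: the noise moves points by a bounded amount, so the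
tails of \<open>\<nu>\<^sub>n\<close> are controlled by those of the single measure \<open>\<mu> * \<eta>\<close>
(\<open>tail_norm_le_convolution\<close>, \<open>tail_norm_le_wasserstein\<close>). The second is convergence of characteristic
functions. Those of \<open>\<nu>\<^sub>n * \<eta>\<close> are products with the characteristic function of \<open>\<eta>\<close>; since
\<open>\<eta>\<close> has compact support, the latter extends to an entire function along every line through the origin,
where it equals 1 at 0, and so it is nonzero on a dense set (\<open>char_fun_nonzero_dense\<close>). It can be divided
out on that set, and the bounded first moments give convergence at all remaining frequencies
(\<open>char_fun_tendsto_of_smoothed\<close>).

These two facts yield \<open>W\<^sub>p(\<nu>\<^sub>n, \<mu>) \<longlonglongrightarrow> 0\<close> after another smoothing, now by a narrow Gaussian \<open>\<gamma>\<close>. It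
displaces each measure by little in \<open>W\<^sub>p\<close>, and the Gaussian is its own Fourier transform, so the density
of \<open>\<nu>\<^sub>n * \<gamma>\<close> at a point is an integral of the characteristic function of \<open>\<nu>\<^sub>n\<close> and therefore converges.
Pointwise convergence of densities makes the total variation distance vanish, and a coupling that keeps
the common mass fixed bounds \<open>W\<^sub>p\<close> by the total variation and the tails (\<open>wasserstein_density_le\<close>).

The triangle inequality for \<open>W\<^sub>p\<close> comes from gluing two couplings approximately, along a countable
partition of the middle space into cells of small diameter (\<open>approximate_gluing\<close>).\<close>

section \<open>\<open>L\<^sup>p\<close> norms with values in the extended half-line\<close>

text \<open>The functional whose infimum over couplings is \<open>wasserstein\<close>, for an arbitrary integrand that is
  meant to be nonnegative. Infinite values are kept, so that the
  inequalities below hold for all measurable integrands.\<close>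

definition Lp_norm :: "real \<Rightarrow> 'b measure \<Rightarrow> ('b \<Rightarrow> real) \<Rightarrow> ennreal"
  where "Lp_norm p M f = ennreal_powr (\<integral>\<^sup>+ x. ennreal (f x powr p) \<partial>M) (1 / p)"

lemma ennreal_powr_mono:
  assumes "x \<le> y" and "0 \<le> r"
  shows "ennreal_powr x r \<le> ennreal_powr y r"
proof (cases "y = \<top>")
  case False
  then have "y < \<top>" "x < \<top>" using assms(1) by (auto simp: less_top[symmetric] top.extremum_uniqueI)
  then show ?thesis
    using assms by (auto simp: ennreal_powr_def intro!: ennreal_leI powr_mono2 enn2real_mono)
qed (simp add: ennreal_powr_def)

lemma Lp_norm_mono_AE:
  assumes "1 \<le> p" and "AE x in M. 0 \<le> f x \<and> f x \<le> g x"
  shows "Lp_norm p M f \<le> Lp_norm p M g"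
  unfolding Lp_norm_def
  using assms by (intro ennreal_powr_mono nn_integral_mono_AE) (auto intro!: ennreal_leI powr_mono2)

lemma Lp_norm_mono:
  assumes "1 \<le> p" and "\<And>x. 0 \<le> f x" "\<And>x. f x \<le> g x"
  shows "Lp_norm p M f \<le> Lp_norm p M g"
  using assms by (intro Lp_norm_mono_AE) auto

text \<open>Passing to the \<open>p\<close>-th power replaces a bound on the norm by a bound on an integral, where the
  estimates are linear.\<close>

lemma Lp_norm_le_iff:
  assumes "1 \<le> p" and "0 \<le> a"
  shows "Lp_norm p M f \<le> ennreal a \<longleftrightarrow> (\<integral>\<^sup>+ x. ennreal (f x powr p) \<partial>M) \<le> ennreal (a powr p)"
proof (cases "(\<integral>\<^sup>+ x. ennreal (f x powr p) \<partial>M)")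
  case (real r)
  have "r powr (1 / p) \<le> a \<longleftrightarrow> r \<le> a powr p"
    using assms real(1) powr_mono2[of "1/p" r "a powr p"] powr_mono2[of p "r powr (1/p)" a]
    by (auto simp: powr_powr)
  then show ?thesis using real assms by (simp add: Lp_norm_def ennreal_powr_def ennreal_le_iff)
next
  case top
  then show ?thesis by (simp add: Lp_norm_def ennreal_powr_def top_unique)
qed

lemma Lp_norm_finite_iff:
  assumes "1 \<le> p"
  shows "Lp_norm p M f < \<top> \<longleftrightarrow> (\<integral>\<^sup>+ x. ennreal (f x powr p) \<partial>M) < \<top>"
  by (auto simp: Lp_norm_def ennreal_powr_def less_top[symmetric])

lemma Lp_norm_distr:
  assumes [measurable]: "T \<in> M \<rightarrow>\<^sub>M N" "f \<in> borel_measurable N"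
  shows "Lp_norm p (distr M N T) f = Lp_norm p M (\<lambda>x. f (T x))"
  unfolding Lp_norm_def by (subst nn_integral_distr) auto

lemma Lp_norm_const:
  assumes "1 \<le> p" and "prob_space M" and "0 \<le> c"
  shows "Lp_norm p M (\<lambda>_. c) = ennreal c"
  using assms by (simp add: Lp_norm_def ennreal_powr_def prob_space.emeasure_space_1 powr_powr)

lemma Lp_norm_cmult_le:
  assumes "1 \<le> p" "0 \<le> c" and f: "\<And>x. 0 \<le> f x" and [measurable]: "f \<in> borel_measurable M"
  shows "Lp_norm p M (\<lambda>x. c * f x) \<le> ennreal c * Lp_norm p M f"
proof (cases "Lp_norm p M f")
  case (real a)
  then have "(\<integral>\<^sup>+ x. ennreal (f x powr p) \<partial>M) \<le> ennreal (a powr p)"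
    using Lp_norm_le_iff[of p a M f] assms(1) by simp
  then have "ennreal (c powr p) * (\<integral>\<^sup>+ x. ennreal (f x powr p) \<partial>M) \<le> ennreal (c powr p) * ennreal (a powr p)"
    by (rule mult_left_mono) simp
  then have "(\<integral>\<^sup>+ x. ennreal ((c * f x) powr p) \<partial>M) \<le> ennreal ((c * a) powr p)"
    using assms real(1) by (simp add: powr_mult ennreal_mult nn_integral_cmult)
  then show ?thesis using Lp_norm_le_iff[of p "c * a" M "\<lambda>x. c * f x"] assms real
    by (simp add: ennreal_mult)
next
  case top
  show ?thesis
  proof (cases "c = 0")
    case True
    then show ?thesis using assms by (simp add: Lp_norm_def ennreal_powr_def)
  next
    case False
    then show ?thesis using top assms by (simp add: ennreal_mult_top)
  qed
qed

text \<open>Convexity of the power function at \<open>u / a\<close> and \<open>v / b\<close>, with the weights for which their mean is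
  \<open>(u + v) / (a + b)\<close>.\<close>

lemma powr_convex_combination:
  fixes u v a b p :: real
  assumes p: "1 \<le> p" and "0 < a" "0 < b" "0 \<le> u" "0 \<le> v"
  shows "(u + v) powr p \<le> (a + b) powr p * (a / (a + b) * (u / a) powr p + b / (a + b) * (v / b) powr p)"
proof -
  let ?s = "a / (a + b)" and ?t = "b / (a + b)"
  have st: "?s + ?t = 1" "0 < ?s" "0 < ?t" using assms by (auto simp: add_divide_distrib[symmetric])
  have key: "(?s * x + ?t * y) powr p \<le> ?s * x powr p + ?t * y powr p" if "0 \<le> x" "0 \<le> y" for x y
  proof -
    \<comment> \<open>The convexity of the power is stated for positive arguments; if one argument is 0, the claim becomes this inequality.\<close>
    have shrink: "(c * z) powr p \<le> c * z powr p" if "0 < c" "c < 1" "0 \<le> z" for c z :: real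
    proof -
      have "c powr p \<le> c powr 1" using that p by (intro powr_mono') auto
      then show ?thesis using that by (simp add: powr_mult mult_right_mono)
    qed
    have lt: "?s < 1" "?t < 1" using st by linarith+
    consider "x = 0" | "y = 0" | "0 < x" "0 < y" using \<open>0 \<le> x\<close> \<open>0 \<le> y\<close> by fastforce
    then show ?thesis
    proof cases
      case 1 then show ?thesis using shrink[of ?t y] st lt that p by simp
    next
      case 2 then show ?thesis using shrink[of ?s x] st lt that p by simp
    next
      case 3
      have s_eq: "1 - ?t = ?s" using st by linarith
      from 3 show ?thesis
        using convex_onD[OF powr_convex[OF p], of ?t x y] st lt s_eq by simp
    qed
  qed
  have "(u + v) powr p = ((a + b) * (?s * (u / a) + ?t * (v / b))) powr p"
    using assms by (simp add: distrib_left)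
  also have "\<dots> = (a + b) powr p * (?s * (u / a) + ?t * (v / b)) powr p"
    by (rule powr_mult)
  also have "\<dots> \<le> (a + b) powr p * (?s * (u / a) powr p + ?t * (v / b) powr p)"
    using assms by (intro mult_left_mono key) auto
  finally show ?thesis .
qed

text \<open>Minkowski's inequality. The convexity bound is integrated with numbers \<open>a\<close>, \<open>b\<close> strictly above the
  two norms, which keeps them positive even if a norm vanishes, and then \<open>a\<close>, \<open>b\<close> decrease to the norms.\<close>

lemma Lp_norm_add_le:
  assumes p: "1 \<le> p" and f: "\<And>x. 0 \<le> f x" and g: "\<And>x. 0 \<le> g x"
    and [measurable]: "f \<in> borel_measurable M" "g \<in> borel_measurable M"
  shows "Lp_norm p M (\<lambda>x. f x + g x) \<le> Lp_norm p M f + Lp_norm p M g"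
proof (cases "Lp_norm p M f = \<top> \<or> Lp_norm p M g = \<top>")
  case False
  then obtain a0 b0 where a0: "0 \<le> a0" "Lp_norm p M f = ennreal a0" and b0: "0 \<le> b0" "Lp_norm p M g = ennreal b0"
    by (metis ennreal_cases)
  have bound: "Lp_norm p M (\<lambda>x. f x + g x) \<le> ennreal (a + b)" if "a0 < a" "b0 < b" for a b
  proof -
    have ab: "0 < a" "0 < b" using that a0 b0 by auto
    have F: "(\<integral>\<^sup>+ x. ennreal (f x powr p) \<partial>M) \<le> ennreal (a powr p)"
      using Lp_norm_le_iff[of p a M f] a0 ab that p by (simp add: ennreal_leI)
    have G: "(\<integral>\<^sup>+ x. ennreal (g x powr p) \<partial>M) \<le> ennreal (b powr p)"
      using Lp_norm_le_iff[of p b M g] b0 ab that p by (simp add: ennreal_leI)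
    let ?A = "(a + b) powr p * (a / (a + b)) / a powr p" and ?B = "(a + b) powr p * (b / (a + b)) / b powr p"
    have "(\<integral>\<^sup>+ x. ennreal ((f x + g x) powr p) \<partial>M) \<le> (\<integral>\<^sup>+ x. ennreal ?A * ennreal (f x powr p) + ennreal ?B * ennreal (g x powr p) \<partial>M)"
    proof (rule nn_integral_mono)
      fix x
      have "(f x + g x) powr p \<le> ?A * f x powr p + ?B * g x powr p"
        using powr_convex_combination[OF p ab f[of x] g[of x]] ab f[of x] g[of x]
        by (simp add: powr_divide algebra_simps)
      then show "ennreal ((f x + g x) powr p) \<le> ennreal ?A * ennreal (f x powr p) + ennreal ?B * ennreal (g x powr p)"
        using ab by (simp add: ennreal_mult[symmetric] ennreal_plus[symmetric] del: ennreal_plus)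
    qed
    also have "\<dots> = ennreal ?A * (\<integral>\<^sup>+ x. ennreal (f x powr p) \<partial>M) + ennreal ?B * (\<integral>\<^sup>+ x. ennreal (g x powr p) \<partial>M)"
      by (simp add: nn_integral_add nn_integral_cmult)
    also have "\<dots> \<le> ennreal ?A * ennreal (a powr p) + ennreal ?B * ennreal (b powr p)"
      by (intro add_mono mult_left_mono F G) auto
    also have "\<dots> = ennreal (?A * a powr p + ?B * b powr p)"
      using ab by (simp add: ennreal_mult[symmetric] ennreal_plus[symmetric] del: ennreal_plus)
    also have "?A * a powr p + ?B * b powr p = (a + b) powr p"
      using ab by (simp add: divide_simps) (simp add: algebra_simps)
    finally show ?thesis using Lp_norm_le_iff[of p "a + b" M "\<lambda>x. f x + g x"] p ab by simp
  qed
  have "Lp_norm p M (\<lambda>x. f x + g x) \<le> ennreal (a0 + b0)"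
  proof (rule ennreal_le_epsilon)
    fix e :: real assume "0 < e"
    then have "Lp_norm p M (\<lambda>x. f x + g x) \<le> ennreal ((a0 + e / 2) + (b0 + e / 2))"
      by (intro bound) auto
    also have "\<dots> = ennreal (a0 + b0) + ennreal e"
      using a0 b0 \<open>0 < e\<close> by (simp add: ennreal_plus[symmetric] del: ennreal_plus)
    finally show "Lp_norm p M (\<lambda>x. f x + g x) \<le> ennreal (a0 + b0) + ennreal e" .
  qed
  then show ?thesis using a0 b0 by simp
qed auto

lemma Lp_norm_le_add:
  assumes p: "1 \<le> p" and "AE x in M. 0 \<le> h x \<and> h x \<le> f x + g x"
    and "\<And>x. 0 \<le> f x" "\<And>x. 0 \<le> g x" "f \<in> borel_measurable M" "g \<in> borel_measurable M"
  shows "Lp_norm p M h \<le> Lp_norm p M f + Lp_norm p M g"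
  using Lp_norm_mono_AE[OF assms(1,2)] Lp_norm_add_le[OF p assms(3-6)] by (rule order_trans)

text \<open>Young's inequality \<open>f / a \<le> (f / a)\<^sup>p / p + (1 - 1 / p)\<close> has a right-hand side of integral at most 1
  as soon as \<open>a\<close> exceeds the \<open>L\<^sup>p\<close> norm.\<close>

lemma nn_integral_le_Lp_norm:
  assumes p: "1 \<le> p" and M: "prob_space M" and f: "\<And>x. 0 \<le> f x" and [measurable]: "f \<in> borel_measurable M"
  shows "(\<integral>\<^sup>+ x. ennreal (f x) \<partial>M) \<le> Lp_norm p M f"
proof (cases "Lp_norm p M f")
  case (real a0)
  interpret prob_space M by fact
  have bound: "(\<integral>\<^sup>+ x. ennreal (f x) \<partial>M) \<le> ennreal a" if "a0 < a" for a
  proof -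
    have a: "0 < a" using that real by simp
    have F: "(\<integral>\<^sup>+ x. ennreal (f x powr p) \<partial>M) \<le> ennreal (a powr p)"
      using Lp_norm_le_iff[of p a M f] a real that p by (simp add: ennreal_leI)
    let ?A = "a / (p * a powr p)" and ?B = "a * (1 - 1 / p)"
    have nn: "0 \<le> ?A" "0 \<le> ?B" using a p by auto
    have "(\<integral>\<^sup>+ x. ennreal (f x) \<partial>M) \<le> (\<integral>\<^sup>+ x. ennreal ?A * ennreal (f x powr p) + ennreal ?B \<partial>M)"
    proof (rule nn_integral_mono)
      fix x
      have "(f x / a) powr (1) * 1 powr (1 - 1 / p) \<le> 1 / p * (f x / a) powr p + (1 - 1 / p) * 1"
        using Youngs_inequality_0[of "1/p" "1 - 1/p" "(f x / a) powr p" 1] f[of x] a p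
        by (cases "f x = 0") (auto simp: powr_powr)
      then have "f x \<le> a * (1 / p * (f x / a) powr p + (1 - 1 / p))"
        using f[of x] a by (simp add: field_simps)
      also have "\<dots> = ?A * f x powr p + ?B" using f[of x] a p by (simp add: powr_divide field_simps)
      finally show "ennreal (f x) \<le> ennreal ?A * ennreal (f x powr p) + ennreal ?B"
        using nn f[of x] by (simp add: ennreal_mult[symmetric] ennreal_plus[symmetric] ennreal_leI del: ennreal_plus times_divide_eq_left)
    qed
    also have "\<dots> = ennreal ?A * (\<integral>\<^sup>+ x. ennreal (f x powr p) \<partial>M) + ennreal ?B"
      by (simp add: nn_integral_add nn_integral_cmult emeasure_space_1)
    also have "\<dots> \<le> ennreal ?A * ennreal (a powr p) + ennreal ?B"
      by (intro add_mono mult_left_mono F) auto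
    also have "\<dots> = ennreal (?A * a powr p + ?B)"
      using nn mult_nonneg_nonneg[OF nn(1), of "a powr p"]
      by (simp only: ennreal_mult[OF nn(1), of "a powr p", symmetric] ennreal_plus powr_ge_zero)
    also have "?A * a powr p + ?B = a"
      using a p by (simp add: divide_simps) (simp add: algebra_simps)
    finally show ?thesis .
  qed
  have "(\<integral>\<^sup>+ x. ennreal (f x) \<partial>M) \<le> ennreal a0"
  proof (rule ennreal_le_epsilon)
    fix e :: real assume "0 < e"
    then show "(\<integral>\<^sup>+ x. ennreal (f x) \<partial>M) \<le> ennreal a0 + ennreal e"
      using bound[of "a0 + e"] real by simp
  qed
  then show ?thesis using real by simp
qed simp

section \<open>Couplings and the triangle inequality\<close>

lemma couplings_D:
  assumes "\<pi> \<in> couplings \<mu> \<nu>"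
  shows "prob_space \<pi>" "sets \<pi> = sets (borel \<Otimes>\<^sub>M borel)" "space \<pi> = UNIV"
    "distr \<pi> borel fst = \<mu>" "distr \<pi> borel snd = \<nu>"
    "sets \<mu> = sets borel" "sets \<nu> = sets borel" "prob_space \<mu>" "prob_space \<nu>"
proof -
  show 1: "prob_space \<pi>" "sets \<pi> = sets (borel \<Otimes>\<^sub>M borel)"
    "distr \<pi> borel fst = \<mu>" "distr \<pi> borel snd = \<nu>"
    using assms by (auto simp: couplings_def)
  show "space \<pi> = UNIV" using sets_eq_imp_space_eq[OF 1(2)] by (simp add: space_pair_measure)
  show "sets \<mu> = sets borel" "sets \<nu> = sets borel" using 1 by auto
  have [measurable]: "fst \<in> \<pi> \<rightarrow>\<^sub>M borel" "snd \<in> \<pi> \<rightarrow>\<^sub>M borel"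
    using 1(2) by (simp_all cong: measurable_cong_sets)
  show "prob_space \<mu>" "prob_space \<nu>"
    using prob_space.prob_space_distr[OF 1(1), of fst borel] prob_space.prob_space_distr[OF 1(1), of snd borel] 1 by auto
qed

lemma coupling_marginals_measurable:
  assumes "\<pi> \<in> couplings \<mu> \<nu>"
  shows "fst \<in> \<pi> \<rightarrow>\<^sub>M borel" "snd \<in> \<pi> \<rightarrow>\<^sub>M borel"
  using couplings_D(2)[OF assms] by (simp_all cong: measurable_cong_sets)

text \<open>It is convenient to let a coupling be the joint law of two random vectors on any probability space;
  the following upper bound for \<open>W\<^sub>p\<close> is then used without naming the law itself.\<close>

lemma couplingI:
  assumes M: "prob_space M" and [measurable]: "X \<in> M \<rightarrow>\<^sub>M borel" "Y \<in> M \<rightarrow>\<^sub>M borel"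
    and "distr M borel X = \<mu>" "distr M borel Y = \<nu>"
  shows "distr M (borel \<Otimes>\<^sub>M borel) (\<lambda>w. (X w, Y w)) \<in> couplings \<mu> \<nu>"
  using assms by (auto simp: couplings_def distr_distr comp_def intro!: prob_space.prob_space_distr)

lemma wasserstein_alt:
  "wasserstein p \<mu> \<nu> = (INF \<pi>\<in>couplings \<mu> \<nu>. Lp_norm p \<pi> (\<lambda>z. norm (fst z - snd z)))"
  unfolding wasserstein_def Lp_norm_def by (simp add: case_prod_beta')

lemma wasserstein_le_Lp_norm:
  fixes X Y :: "'b \<Rightarrow> 'a::euclidean_space"
  assumes "prob_space M" and [measurable]: "X \<in> M \<rightarrow>\<^sub>M borel" "Y \<in> M \<rightarrow>\<^sub>M borel"
    and "distr M borel X = \<mu>" "distr M borel Y = \<nu>"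
  shows "wasserstein p \<mu> \<nu> \<le> Lp_norm p M (\<lambda>w. norm (X w - Y w))"
proof -
  have "Lp_norm p M (\<lambda>w. norm (X w - Y w)) = Lp_norm p (distr M (borel \<Otimes>\<^sub>M borel) (\<lambda>w. (X w, Y w))) (\<lambda>z. norm (fst z - snd z))"
    by (subst Lp_norm_distr) auto
  then show ?thesis unfolding wasserstein_alt using INF_lower[OF couplingI[OF assms]] by simp
qed

lemma wasserstein_less_obtain:
  assumes "wasserstein p \<mu> \<nu> < c"
  obtains \<pi> where "\<pi> \<in> couplings \<mu> \<nu>" "Lp_norm p \<pi> (\<lambda>z. norm (fst z - snd z)) < c"
  using assms unfolding wasserstein_alt INF_less_iff by blast

lemma wasserstein_greatest:
  assumes "\<And>\<pi>. \<pi> \<in> couplings \<mu> \<nu> \<Longrightarrow> c \<le> Lp_norm p \<pi> (\<lambda>z. norm (fst z - snd z))"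
  shows "c \<le> wasserstein p \<mu> \<nu>"
  unfolding wasserstein_alt using assms by (rule INF_greatest)

lemma wasserstein_commute_le: "wasserstein p \<mu> \<nu> \<le> wasserstein p \<nu> \<mu>"
proof (rule wasserstein_greatest)
  fix \<pi> assume \<pi>: "\<pi> \<in> couplings \<nu> \<mu>"
  note couplings_D[OF \<pi>] coupling_marginals_measurable[OF \<pi>, measurable]
  then have "wasserstein p \<mu> \<nu> \<le> Lp_norm p \<pi> (\<lambda>w. norm (snd w - fst w))"
    by (intro wasserstein_le_Lp_norm) auto
  then show "wasserstein p \<mu> \<nu> \<le> Lp_norm p \<pi> (\<lambda>w. norm (fst w - snd w))"
    by (simp add: norm_minus_commute)
qed

lemma wasserstein_commute: "wasserstein p \<mu> \<nu> = wasserstein p \<nu> \<mu>"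
  using wasserstein_commute_le by (metis antisym)

lemma wasserstein_refl:
  assumes "prob_space \<mu>" "sets \<mu> = sets borel"
  shows "wasserstein p \<mu> \<mu> = 0"
proof -
  have [measurable]: "(\<lambda>x. x) \<in> \<mu> \<rightarrow>\<^sub>M borel" using assms by (simp cong: measurable_cong_sets)
  have "distr \<mu> borel (\<lambda>x. x) = \<mu>" using assms distr_id2 by metis
  from wasserstein_le_Lp_norm[OF assms(1) _ _ this this, of p]
  show ?thesis by (simp add: Lp_norm_def ennreal_powr_def)
qed

lemma Lp_norm_coupling:
  assumes \<pi>: "\<pi> \<in> couplings \<mu> \<nu>" and "f \<in> borel_measurable borel"
  shows "Lp_norm p \<pi> (\<lambda>z. f (fst z)) = Lp_norm p \<mu> f" "Lp_norm p \<pi> (\<lambda>z. f (snd z)) = Lp_norm p \<nu> f"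
  using couplings_D[OF \<pi>] coupling_marginals_measurable[OF \<pi>] assms
  by (metis Lp_norm_distr)+

text \<open>The index of the first point of a dense sequence at distance less than \<open>e / 2\<close>. Its fibres
  partition the space into countably many measurable cells.\<close>

lemma small_cells_index:
  fixes e :: real
  assumes "0 < e"
  obtains q :: "'a::euclidean_space \<Rightarrow> nat" where "q \<in> borel \<rightarrow>\<^sub>M count_space UNIV"
    "\<And>x y. q x = q y \<Longrightarrow> dist x y < e"
proof -
  obtain D :: "'a set" where D: "countable D" "\<And>U. open U \<Longrightarrow> U \<noteq> {} \<Longrightarrow> \<exists>d\<in>D. d \<in> U"
    using countable_dense_exists by blast
  define d where "d = from_nat_into D"
  have "D \<noteq> {}" using D(2)[of UNIV] by auto
  have ex: "\<exists>n. dist x (d n) < e / 2" for x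
  proof -
    obtain y where "y \<in> D" "y \<in> ball x (e / 2)" using D(2)[of "ball x (e/2)"] assms by auto
    then show ?thesis unfolding d_def
      by (metis D(1) \<open>D \<noteq> {}\<close> from_nat_into_surj mem_ball)
  qed
  define q where "q = (\<lambda>x. LEAST n. dist x (d n) < e / 2)"
  have q: "dist x (d (q x)) < e / 2" for x unfolding q_def by (rule LeastI_ex[OF ex])
  show ?thesis
  proof
    show "q \<in> borel \<rightarrow>\<^sub>M count_space UNIV" unfolding q_def by measurable
    show "dist x y < e" if "q x = q y" for x y
      using q[of x] q[of y] that dist_triangle_half_r[of "d (q x)" x e y] by (simp add: dist_commute)
  qed
qed

text \<open>An exact gluing along the common marginal would be built from conditional laws. Here the
  product measure is instead restricted to pairs whose middle points lie in the same cell and divided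
  by the mass of that cell. Integrating out either pair gives weight 1 to the other one, so both
  couplings survive as marginals; the price is that the two middle points agree only up to the
  diameter of a cell.\<close>

lemma approximate_gluing:
  fixes \<mu>1 \<mu>2 \<mu>3 :: "'a::euclidean_space measure"
  assumes \<pi>: "\<pi> \<in> couplings \<mu>1 \<mu>2" and \<rho>: "\<rho> \<in> couplings \<mu>2 \<mu>3" and "0 < e"
  obtains \<gamma> where "sets \<gamma> = sets (\<pi> \<Otimes>\<^sub>M \<rho>)" "distr \<gamma> \<pi> fst = \<pi>" "distr \<gamma> \<rho> snd = \<rho>"
    "AE w in \<gamma>. dist (snd (fst w)) (fst (snd w)) < e"
proof -
  note P = couplings_D[OF \<pi>] and R = couplings_D[OF \<rho>]
  note [measurable] = coupling_marginals_measurable[OF \<pi>] coupling_marginals_measurable[OF \<rho>]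
  interpret P: prob_space \<pi> by (rule P)
  interpret R: prob_space \<rho> by (rule R)
  interpret PR: pair_prob_space \<pi> \<rho> ..
  interpret M: prob_space \<mu>2 by (rule P)
  obtain q :: "'a \<Rightarrow> nat" where q[measurable]: "q \<in> borel \<rightarrow>\<^sub>M count_space UNIV"
    and q_close: "\<And>x y. q x = q y \<Longrightarrow> dist x y < e"
    using small_cells_index[OF \<open>0 < e\<close>] by blast
  define c where "c k = emeasure \<mu>2 (q -` {k})" for k
  define h where "h w = (if q (snd (fst w)) = q (fst (snd w)) then inverse (c (q (snd (fst w)))) else (0::ennreal))"
    for w :: "('a \<times> 'a) \<times> ('a \<times> 'a)"
  define \<gamma> where "\<gamma> = density (\<pi> \<Otimes>\<^sub>M \<rho>) h"
  have q_meas: "(\<lambda>u. q (snd u)) \<in> \<pi> \<rightarrow>\<^sub>M count_space UNIV" "(\<lambda>v. q (fst v)) \<in> \<rho> \<rightarrow>\<^sub>M count_space UNIV"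
    by measurable
  have h_pieces: "(\<lambda>w. q (snd (fst w))) \<in> \<pi> \<Otimes>\<^sub>M \<rho> \<rightarrow>\<^sub>M count_space UNIV"
    "(\<lambda>w. q (fst (snd w))) \<in> \<pi> \<Otimes>\<^sub>M \<rho> \<rightarrow>\<^sub>M count_space UNIV"
    using measurable_compose[OF measurable_fst q_meas(1)] measurable_compose[OF measurable_snd q_meas(2)] by auto
  have [measurable]: "h \<in> borel_measurable (\<pi> \<Otimes>\<^sub>M \<rho>)" 
    unfolding h_def[abs_def]
  proof (rule measurable_If)
    show "(\<lambda>w. inverse (c (q (snd (fst w))))) \<in> borel_measurable (\<pi> \<Otimes>\<^sub>M \<rho>)"
      using measurable_compose[OF h_pieces(1), of "\<lambda>k. inverse (c k)" borel] by simp
    have "{w \<in> space (\<pi> \<Otimes>\<^sub>M \<rho>). q (snd (fst w)) = q (fst (snd w))} =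
      (\<Union>k. ((\<lambda>w. q (snd (fst w))) -` {k} \<inter> space (\<pi> \<Otimes>\<^sub>M \<rho>)) \<inter> ((\<lambda>w. q (fst (snd w))) -` {k} \<inter> space (\<pi> \<Otimes>\<^sub>M \<rho>)))"
      by auto
    also have "\<dots> \<in> sets (\<pi> \<Otimes>\<^sub>M \<rho>)"
      by (intro sets.countable_UN' sets.Int measurable_sets[OF h_pieces(1)] measurable_sets[OF h_pieces(2)]) auto
    finally show "{w \<in> space (\<pi> \<Otimes>\<^sub>M \<rho>). q (snd (fst w)) = q (fst (snd w))} \<in> sets (\<pi> \<Otimes>\<^sub>M \<rho>)" .
  qed simp
  have [measurable]: "q -` {k} \<in> sets borel" for k
    using measurable_sets[OF q, of "{k}"] by simp
  have c_fin: "c k < \<top>" for k unfolding c_def by (simp add: M.emeasure_finite less_top[symmetric])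
  have c_pi: "emeasure \<pi> {u \<in> space \<pi>. q (snd u) = k} = c k" for k
  proof -
    have "c k = emeasure (distr \<pi> borel snd) (q -` {k})" unfolding c_def P by simp
    also have "\<dots> = emeasure \<pi> {u \<in> space \<pi>. q (snd u) = k}"
      by (subst emeasure_distr) (auto intro!: arg_cong[where f="emeasure \<pi>"])
    finally show ?thesis by simp
  qed
  have c_rho: "emeasure \<rho> {v \<in> space \<rho>. q (fst v) = k} = c k" for k
  proof -
    have "c k = emeasure (distr \<rho> borel fst) (q -` {k})" unfolding c_def R by simp
    also have "\<dots> = emeasure \<rho> {v \<in> space \<rho>. q (fst v) = k}"
      by (subst emeasure_distr) (auto intro!: arg_cong[where f="emeasure \<rho>"])
    finally show ?thesis by simp
  qed
  \<comment> \<open>Points in a cell of measure zero form a null set, so the normalisation succeeds almost everywhere.\<close>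
  have pos_pi: "AE u in \<pi>. c (q (snd u)) \<noteq> 0"
  proof -
    have "AE u in \<pi>. \<forall>k. c k = 0 \<longrightarrow> q (snd u) \<noteq> k"
    proof (subst AE_all_countable, rule allI)
      fix k
      show "AE u in \<pi>. c k = 0 \<longrightarrow> q (snd u) \<noteq> k"
        using c_pi[of k] by (cases "c k = 0") (auto simp: AE_iff_measurable[OF _ refl])
    qed
    then show ?thesis by auto
  qed
  have pos_rho: "AE u in \<rho>. c (q (fst u)) \<noteq> 0"
  proof -
    have "AE u in \<rho>. \<forall>k. c k = 0 \<longrightarrow> q (fst u) \<noteq> k"
    proof (subst AE_all_countable, rule allI)
      fix k
      show "AE u in \<rho>. c k = 0 \<longrightarrow> q (fst u) \<noteq> k"
        using c_rho[of k] by (cases "c k = 0") (auto simp: AE_iff_measurable[OF _ refl])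
    qed
    then show ?thesis by auto
  qed
  have int_pi: "(\<integral>\<^sup>+ v. h (u, v) \<partial>\<rho>) = 1" if "c (q (snd u)) \<noteq> 0" for u
  proof -
    have "(\<integral>\<^sup>+ v. h (u, v) \<partial>\<rho>) = (\<integral>\<^sup>+ v. inverse (c (q (snd u))) * indicator {v \<in> space \<rho>. q (fst v) = q (snd u)} v \<partial>\<rho>)"
      by (intro nn_integral_cong) (auto simp: h_def split: split_indicator)
    also have "\<dots> = inverse (c (q (snd u))) * c (q (snd u))"
      by (subst nn_integral_cmult_indicator) (auto simp: c_rho)
    finally show ?thesis using that c_fin by (simp add: ennreal_inverse_mult less_top mult.commute ennreal_divide_self divide_ennreal_def[symmetric])
  qed
  have int_rho: "(\<integral>\<^sup>+ u. h (u, v) \<partial>\<pi>) = 1" if "c (q (fst v)) \<noteq> 0" for v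
  proof -
    have "(\<integral>\<^sup>+ u. h (u, v) \<partial>\<pi>) = (\<integral>\<^sup>+ u. inverse (c (q (fst v))) * indicator {u \<in> space \<pi>. q (snd u) = q (fst v)} u \<partial>\<pi>)"
      by (intro nn_integral_cong) (auto simp: h_def split: split_indicator)
    also have "\<dots> = inverse (c (q (fst v))) * c (q (fst v))"
      by (subst nn_integral_cmult_indicator) (auto simp: c_pi)
    finally show ?thesis using that c_fin by (simp add: ennreal_inverse_mult less_top mult.commute ennreal_divide_self divide_ennreal_def[symmetric])
  qed
  have [measurable]: "fst \<in> \<gamma> \<rightarrow>\<^sub>M \<pi>" "snd \<in> \<gamma> \<rightarrow>\<^sub>M \<rho>" unfolding \<gamma>_def by measurable
  show thesis
  proof
    show "sets \<gamma> = sets (\<pi> \<Otimes>\<^sub>M \<rho>)" by (simp add: \<gamma>_def)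
    show "distr \<gamma> \<pi> fst = \<pi>"
    proof (rule measure_eqI)
      fix A assume "A \<in> sets (distr \<gamma> \<pi> fst)"
      then have [measurable]: "A \<in> sets \<pi>" by simp
      have "emeasure (distr \<gamma> \<pi> fst) A = (\<integral>\<^sup>+ w. indicator A (fst w) \<partial>\<gamma>)"
        using nn_integral_distr[of fst \<gamma> \<pi> "indicator A"] by simp
      also have "\<dots> = (\<integral>\<^sup>+ w. h w * indicator A (fst w) \<partial>(\<pi> \<Otimes>\<^sub>M \<rho>))"
        unfolding \<gamma>_def by (subst nn_integral_density) auto
      also have "\<dots> = (\<integral>\<^sup>+ u. \<integral>\<^sup>+ v. h (u, v) * indicator A u \<partial>\<rho> \<partial>\<pi>)"
        by (subst R.nn_integral_fst[symmetric]) auto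
      also have "\<dots> = (\<integral>\<^sup>+ u. indicator A u \<partial>\<pi>)"
        using pos_pi by (intro nn_integral_cong_AE) (auto simp: nn_integral_multc int_pi)
      finally show "emeasure (distr \<gamma> \<pi> fst) A = emeasure \<pi> A" by simp
    qed simp
    show "distr \<gamma> \<rho> snd = \<rho>"
    proof (rule measure_eqI)
      fix A assume "A \<in> sets (distr \<gamma> \<rho> snd)"
      then have [measurable]: "A \<in> sets \<rho>" by simp
      have "emeasure (distr \<gamma> \<rho> snd) A = (\<integral>\<^sup>+ w. indicator A (snd w) \<partial>\<gamma>)"
        using nn_integral_distr[of snd \<gamma> \<rho> "indicator A"] by simp
      also have "\<dots> = (\<integral>\<^sup>+ w. h w * indicator A (snd w) \<partial>(\<pi> \<Otimes>\<^sub>M \<rho>))"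
        unfolding \<gamma>_def by (subst nn_integral_density) auto
      also have "\<dots> = (\<integral>\<^sup>+ v. \<integral>\<^sup>+ u. h (u, v) * indicator A v \<partial>\<pi> \<partial>\<rho>)"
        by (subst PR.nn_integral_snd[symmetric]) auto
      also have "\<dots> = (\<integral>\<^sup>+ v. indicator A v \<partial>\<rho>)"
        using pos_rho by (intro nn_integral_cong_AE) (auto simp: nn_integral_multc int_rho)
      finally show "emeasure (distr \<gamma> \<rho> snd) A = emeasure \<rho> A" by simp
    qed simp
    show "AE w in \<gamma>. dist (snd (fst w)) (fst (snd w)) < e"
      unfolding \<gamma>_def by (subst AE_density) (auto simp: h_def q_close)
  qed
qed

text \<open>Together with \<open>wasserstein_less_obtain\<close>, this provides almost optimal couplings.\<close>

lemma ennreal_less_add_pos: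
  assumes "x < \<top>" and "0 < e"
  shows "x < x + ennreal e"
  using assms by (cases x) (auto simp: ennreal_plus[symmetric] ennreal_less_iff simp del: ennreal_plus)

text \<open>Minkowski's inequality on a space carrying both couplings; the gap between the middle points
  contributes \<open>e\<close>, which is arbitrary.\<close>

lemma wasserstein_triangle:
  fixes \<mu>1 \<mu>2 \<mu>3 :: "'a::euclidean_space measure"
  assumes p: "1 \<le> p"
  shows "wasserstein p \<mu>1 \<mu>3 \<le> wasserstein p \<mu>1 \<mu>2 + wasserstein p \<mu>2 \<mu>3"
proof -
  let ?N = "\<lambda>M. Lp_norm p M (\<lambda>z. norm (fst z - snd z))"
  have step: "wasserstein p \<mu>1 \<mu>3 \<le> ?N \<pi> + ?N \<rho>"
    if \<pi>: "\<pi> \<in> couplings \<mu>1 \<mu>2" and \<rho>: "\<rho> \<in> couplings \<mu>2 \<mu>3" for \<pi> \<rho>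
  proof (rule ennreal_le_epsilon)
    fix e :: real assume e: "0 < e"
    obtain \<gamma> where \<gamma>: "sets \<gamma> = sets (\<pi> \<Otimes>\<^sub>M \<rho>)" "distr \<gamma> \<pi> fst = \<pi>" "distr \<gamma> \<rho> snd = \<rho>"
      and close: "AE w in \<gamma>. dist (snd (fst w)) (fst (snd w)) < e"
      using approximate_gluing[OF \<pi> \<rho> e] by blast
    note P = couplings_D[OF \<pi>] and R = couplings_D[OF \<rho>]
    note [measurable] = coupling_marginals_measurable[OF \<pi>] coupling_marginals_measurable[OF \<rho>]
    have [measurable]: "fst \<in> \<gamma> \<rightarrow>\<^sub>M \<pi>" "snd \<in> \<gamma> \<rightarrow>\<^sub>M \<rho>" using \<gamma>(1) by (simp_all cong: measurable_cong_sets)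
    interpret G: prob_space \<gamma>
      using prob_space_distrD[of fst \<gamma> \<pi>] P(1) \<gamma>(2) by simp
    have "wasserstein p \<mu>1 \<mu>3 \<le> Lp_norm p \<gamma> (\<lambda>w. norm (fst (fst w) - snd (snd w)))"
    proof (rule wasserstein_le_Lp_norm)
      show "distr \<gamma> borel (\<lambda>w. fst (fst w)) = \<mu>1"
        using distr_distr[of fst \<pi> borel fst \<gamma>] \<gamma> P by (simp add: comp_def)
      show "distr \<gamma> borel (\<lambda>w. snd (snd w)) = \<mu>3"
        using distr_distr[of snd \<rho> borel snd \<gamma>] \<gamma> R by (simp add: comp_def)
    qed (auto intro: G.prob_space_axioms)
    also have "\<dots> \<le> Lp_norm p \<gamma> (\<lambda>w. norm (fst (fst w) - snd (fst w)) + norm (fst (snd w) - snd (snd w))) + Lp_norm p \<gamma> (\<lambda>_. e)"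
    proof (rule Lp_norm_le_add[OF p])
      show "AE w in \<gamma>. 0 \<le> norm (fst (fst w) - snd (snd w)) \<and>
          norm (fst (fst w) - snd (snd w)) \<le> norm (fst (fst w) - snd (fst w)) + norm (fst (snd w) - snd (snd w)) + e"
        using close
      proof eventually_elim
        case (elim w)
        then show ?case
          using dist_triangle[of "fst (fst w)" "snd (snd w)" "snd (fst w)"] dist_triangle[of "snd (fst w)" "snd (snd w)" "fst (snd w)"]
          by (simp add: dist_norm)
      qed
    qed (use e in auto)
    also have "\<dots> \<le> Lp_norm p \<gamma> (\<lambda>w. norm (fst (fst w) - snd (fst w))) + Lp_norm p \<gamma> (\<lambda>w. norm (fst (snd w) - snd (snd w))) + ennreal e"
      using p e by (intro add_mono Lp_norm_add_le) (auto simp: Lp_norm_const G.prob_space_axioms)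
    also have "Lp_norm p \<gamma> (\<lambda>w. norm (fst (fst w) - snd (fst w))) = ?N \<pi>"
      using Lp_norm_distr[of fst \<gamma> \<pi> "\<lambda>z. norm (fst z - snd z)" p] \<gamma>(2) by simp
    also have "Lp_norm p \<gamma> (\<lambda>w. norm (fst (snd w) - snd (snd w))) = ?N \<rho>"
      using Lp_norm_distr[of snd \<gamma> \<rho> "\<lambda>z. norm (fst z - snd z)" p] \<gamma>(3) by simp
    finally show "wasserstein p \<mu>1 \<mu>3 \<le> ?N \<pi> + ?N \<rho> + ennreal e" .
  qed
  show ?thesis
  proof (rule ennreal_le_epsilon)
    fix e :: real assume e: "0 < e" and fin: "wasserstein p \<mu>1 \<mu>2 + wasserstein p \<mu>2 \<mu>3 < \<top>"
    then have lt: "wasserstein p \<mu>1 \<mu>2 < wasserstein p \<mu>1 \<mu>2 + ennreal (e/2)" "wasserstein p \<mu>2 \<mu>3 < wasserstein p \<mu>2 \<mu>3 + ennreal (e/2)"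
      by (auto intro: ennreal_less_add_pos)
    obtain \<pi> where \<pi>: "\<pi> \<in> couplings \<mu>1 \<mu>2" "?N \<pi> < wasserstein p \<mu>1 \<mu>2 + ennreal (e/2)"
      using wasserstein_less_obtain[OF lt(1)] .
    obtain \<rho> where \<rho>: "\<rho> \<in> couplings \<mu>2 \<mu>3" "?N \<rho> < wasserstein p \<mu>2 \<mu>3 + ennreal (e/2)"
      using wasserstein_less_obtain[OF lt(2)] .
    have "wasserstein p \<mu>1 \<mu>3 \<le> (wasserstein p \<mu>1 \<mu>2 + ennreal (e/2)) + (wasserstein p \<mu>2 \<mu>3 + ennreal (e/2))"
      using step[OF \<pi>(1) \<rho>(1)] \<pi>(2) \<rho>(2) by (meson add_mono less_imp_le order_trans)
    also have "\<dots> = wasserstein p \<mu>1 \<mu>2 + wasserstein p \<mu>2 \<mu>3 + (ennreal (e/2) + ennreal (e/2))"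
      by (simp add: algebra_simps)
    also have "ennreal (e/2) + ennreal (e/2) = ennreal e" using e by (simp add: ennreal_plus[symmetric] del: ennreal_plus)
    finally show "wasserstein p \<mu>1 \<mu>3 \<le> wasserstein p \<mu>1 \<mu>2 + wasserstein p \<mu>2 \<mu>3 + ennreal e" .
  qed
qed

section \<open>Test functions, tails and finiteness\<close>

lemma distr_pair_marginals:
  assumes "prob_space \<mu>" "prob_space \<nu>"
  shows "distr (\<mu> \<Otimes>\<^sub>M \<nu>) \<mu> fst = \<mu>" "distr (\<mu> \<Otimes>\<^sub>M \<nu>) \<nu> snd = \<nu>"
proof -
  interpret M: prob_space \<mu> by fact
  interpret N: prob_space \<nu> by fact
  interpret P: pair_prob_space \<mu> \<nu> ..
  show "distr (\<mu> \<Otimes>\<^sub>M \<nu>) \<mu> fst = \<mu>" by (rule N.distr_pair_fst)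
  show "distr (\<mu> \<Otimes>\<^sub>M \<nu>) \<nu> snd = \<nu>"
  proof (rule measure_eqI)
    fix A assume "A \<in> sets (distr (\<mu> \<Otimes>\<^sub>M \<nu>) \<nu> snd)"
    then have A: "A \<in> sets \<nu>" by simp
    have "snd -` A \<inter> space (\<mu> \<Otimes>\<^sub>M \<nu>) = space \<mu> \<times> A"
      using sets.sets_into_space[OF A] by (auto simp: space_pair_measure)
    then show "emeasure (distr (\<mu> \<Otimes>\<^sub>M \<nu>) \<nu> snd) A = emeasure \<nu> A"
      using A by (simp add: emeasure_distr N.emeasure_pair_measure_Times M.emeasure_space_1)
  qed simp
qed

lemma distr_pair_marginals_borel:
  assumes "prob_space \<mu>" "sets \<mu> = sets borel" "prob_space \<nu>" "sets \<nu> = sets borel"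
  shows "distr (\<mu> \<Otimes>\<^sub>M \<nu>) borel fst = \<mu>" "distr (\<mu> \<Otimes>\<^sub>M \<nu>) borel snd = \<nu>"
  using distr_pair_marginals[OF assms(1,3)] distr_cong[OF refl assms(2), of "\<mu> \<Otimes>\<^sub>M \<nu>" fst fst]
    distr_cong[OF refl assms(4), of "\<mu> \<Otimes>\<^sub>M \<nu>" snd snd] by metis+

lemma prob_space_pair_measure:
  assumes "prob_space \<mu>" "prob_space \<nu>"
  shows "prob_space (\<mu> \<Otimes>\<^sub>M \<nu>)"
proof -
  interpret M: prob_space \<mu> by fact
  interpret N: prob_space \<nu> by fact
  interpret P: pair_prob_space \<mu> \<nu> ..
  show ?thesis by (rule P.prob_space_axioms)
qed

text \<open>The elementary half of Kantorovich duality. Vector values are allowed because it is applied both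
  to real cut-off functions and to complex exponentials.\<close>

lemma integral_lipschitz_diff_le:
  fixes f :: "'a::euclidean_space \<Rightarrow> 'b::{banach, second_countable_topology}"
  assumes p: "1 \<le> p" and W: "wasserstein p \<mu> \<nu> < ennreal s"
    and [measurable]: "f \<in> borel_measurable borel" and B: "\<And>x. norm (f x) \<le> B"
    and L: "0 \<le> L" "\<And>x y. norm (f x - f y) \<le> L * norm (x - y)"
  shows "norm ((\<integral>x. f x \<partial>\<mu>) - (\<integral>x. f x \<partial>\<nu>)) \<le> L * s"
proof -
  obtain \<pi> where \<pi>: "\<pi> \<in> couplings \<mu> \<nu>" and less: "Lp_norm p \<pi> (\<lambda>z. norm (fst z - snd z)) < ennreal s"
    using wasserstein_less_obtain[OF W] .
  have s: "0 \<le> s" using W by (metis ennreal_eq_0_iff linorder_le_cases not_less_zero)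
  note P = couplings_D[OF \<pi>]
  note [measurable] = coupling_marginals_measurable[OF \<pi>]
  interpret prob_space \<pi> by (rule P)
  have int: "integrable \<pi> (\<lambda>z. f (fst z))" "integrable \<pi> (\<lambda>z. f (snd z))"
    using B by (auto intro!: integrable_const_bound[where B=B])
  have "(\<integral>x. f x \<partial>\<mu>) = (\<integral>z. f (fst z) \<partial>\<pi>)" "(\<integral>x. f x \<partial>\<nu>) = (\<integral>z. f (snd z) \<partial>\<pi>)"
    using integral_distr[of fst \<pi> borel f] integral_distr[of snd \<pi> borel f] P by simp_all
  then have "ennreal (norm ((\<integral>x. f x \<partial>\<mu>) - (\<integral>x. f x \<partial>\<nu>))) = ennreal (norm (\<integral>z. f (fst z) - f (snd z) \<partial>\<pi>))"
    using int by simp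
  also have "\<dots> \<le> (\<integral>\<^sup>+ z. ennreal (norm (f (fst z) - f (snd z))) \<partial>\<pi>)"
    using int by (intro integral_norm_bound_ennreal) auto
  also have "\<dots> \<le> (\<integral>\<^sup>+ z. ennreal L * ennreal (norm (fst z - snd z)) \<partial>\<pi>)"
    using L by (intro nn_integral_mono) (auto simp: ennreal_mult[symmetric] intro!: ennreal_leI)
  also have "\<dots> \<le> ennreal L * Lp_norm p \<pi> (\<lambda>z. norm (fst z - snd z))"
    by (subst nn_integral_cmult) (auto intro!: mult_left_mono nn_integral_le_Lp_norm p prob_space_axioms)
  also have "\<dots> \<le> ennreal L * ennreal s" using less by (intro mult_left_mono) auto
  finally show ?thesis using L s by (simp add: ennreal_mult[symmetric])
qed

text \<open>The two measures give the same integral to every bounded Lipschitz function. The indicator of a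
  closed set is a decreasing limit of such functions, and closed sets determine a
  finite Borel measure.\<close>

lemma wasserstein_eq_0_imp_eq:
  fixes \<mu> \<nu> :: "'a::euclidean_space measure"
  assumes p: "1 \<le> p" and W: "wasserstein p \<mu> \<nu> = 0"
    and M: "prob_space \<mu>" "sets \<mu> = sets borel" "prob_space \<nu>" "sets \<nu> = sets borel"
  shows "\<mu> = \<nu>"
proof -
  interpret M: prob_space \<mu> by fact
  interpret N: prob_space \<nu> by fact
  have closed: "measure \<mu> F = measure \<nu> F" if F: "closed F" for F
  proof (cases "F = {}")
    case False
    \<comment> \<open>Lipschitz with constant \<open>k\<close>, and decreasing to the indicator of \<open>F\<close>.\<close>
    define f where "f k x = max 0 (1 - real k * infdist x F)" for k x
    have f_meas: "f k \<in> borel_measurable borel" for k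
      unfolding f_def[abs_def] by (intro borel_measurable_continuous_onI continuous_intros)
    have f_bound: "norm (f k x) \<le> 1" for k x
      by (auto simp: f_def infdist_nonneg)
    have f_lip: "norm (f k x - f k y) \<le> real k * norm (x - y)" for k x y
    proof -
      have "\<bar>real k * infdist x F - real k * infdist y F\<bar> = real k * \<bar>infdist x F - infdist y F\<bar>"
        by (simp add: abs_mult right_diff_distrib[symmetric])
      also have "\<dots> \<le> real k * dist x y" by (intro mult_left_mono infdist_triangle_abs) auto
      finally show ?thesis by (auto simp: f_def dist_norm)
    qed
    have f_lim: "(\<lambda>k. f k x) \<longlonglongrightarrow> indicator F x" for x
    proof (cases "x \<in> F")
      case True then show ?thesis by (simp add: f_def)
    next
      case xF: False
      then have d: "0 < infdist x F" using F False by (simp add: infdist_pos_not_in_closed)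
      obtain K :: nat where K: "1 / infdist x F < real K" using reals_Archimedean2 by blast
      have "f k x = 0" if "K \<le> k" for k
      proof -
        have "1 / infdist x F < real k" using K that by simp
        then show ?thesis using d by (simp add: f_def divide_less_eq)
      qed
      then have "\<forall>\<^sub>F k in sequentially. f k x = 0" using eventually_sequentially by blast
      then show ?thesis using xF by (simp add: tendsto_eventually)
    qed
    have eq: "(\<integral>x. f k x \<partial>\<mu>) = (\<integral>x. f k x \<partial>\<nu>)" for k
    proof -
      have "norm ((\<integral>x. f k x \<partial>\<mu>) - (\<integral>x. f k x \<partial>\<nu>)) \<le> 0"
      proof (rule field_le_epsilon)
        fix e :: real assume "0 < e"
        have "norm ((\<integral>x. f k x \<partial>\<mu>) - (\<integral>x. f k x \<partial>\<nu>)) \<le> real k * (e / (1 + real k))"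
          using \<open>0 < e\<close> W by (intro integral_lipschitz_diff_le[OF p _ f_meas f_bound _ f_lip]) auto
        also have "\<dots> \<le> e" using \<open>0 < e\<close> by (simp add: field_simps)
        finally show "norm ((\<integral>x. f k x \<partial>\<mu>) - (\<integral>x. f k x \<partial>\<nu>)) \<le> 0 + e" by simp
      qed
      then show ?thesis by simp
    qed
    have lim: "(\<lambda>k. \<integral>x. f k x \<partial>\<rho>) \<longlonglongrightarrow> measure \<rho> F" if "prob_space \<rho>" "sets \<rho> = sets borel" for \<rho> :: "'a measure"
    proof -
      interpret R: prob_space \<rho> by fact
      have [measurable_cong]: "sets \<rho> = sets borel" by fact
      have FF: "F \<in> sets \<rho>" using F that by simp
      have "(\<lambda>k. \<integral>x. f k x \<partial>\<rho>) \<longlonglongrightarrow> (\<integral>x. indicator F x \<partial>\<rho>)"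
        using f_lim f_bound f_meas FF by (intro integral_dominated_convergence[where w="\<lambda>_. 1"]) (auto cong: measurable_cong_sets)
      then show ?thesis using FF sets.sets_into_space[OF FF] by (simp add: Int_absorb2)
    qed
    show ?thesis using LIMSEQ_unique[OF lim[OF M(1,2)]] lim[OF M(3,4)] by (simp add: eq)
  qed simp
  show ?thesis
  proof (rule measure_eqI_generator_eq[where E="Collect closed" and \<Omega>=UNIV and A="\<lambda>_. UNIV"])
    show "Int_stable (Collect (closed :: 'a set \<Rightarrow> bool))" by (auto simp: Int_stable_def)
    show "sets \<mu> = sigma_sets UNIV (Collect closed)" "sets \<nu> = sigma_sets UNIV (Collect closed)"
      using M by (simp_all add: borel_eq_closed)
    show "emeasure \<mu> X = emeasure \<nu> X" if "X \<in> Collect closed" for X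
      using closed[of X] that by (simp add: M.emeasure_eq_measure N.emeasure_eq_measure)
  qed auto
qed

text \<open>A quantitative form of uniform integrability. Subtracting \<open>R\<close> from the norm, instead of cutting it
  off at \<open>R\<close>, makes the integrand 1-Lipschitz, so that the tail norm is 1-Lipschitz for \<open>W\<^sub>p\<close>. Negative
  \<open>R\<close> occur and give bounds on moments.\<close>

definition tail_norm :: "real \<Rightarrow> real \<Rightarrow> 'a::euclidean_space measure \<Rightarrow> ennreal"
  where "tail_norm p R \<mu> = Lp_norm p \<mu> (\<lambda>x. max 0 (norm x - R))"

lemma tail_norm_le_wasserstein:
  assumes p: "1 \<le> p"
  shows "tail_norm p R \<mu> \<le> tail_norm p R \<nu> + wasserstein p \<mu> \<nu>"
proof (rule ennreal_le_epsilon)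
  fix e :: real assume "0 < e" and "tail_norm p R \<nu> + wasserstein p \<mu> \<nu> < \<top>"
  then have "wasserstein p \<mu> \<nu> < wasserstein p \<mu> \<nu> + ennreal e"
    by (intro ennreal_less_add_pos) auto
  then obtain \<pi> where \<pi>: "\<pi> \<in> couplings \<mu> \<nu>" and
    less: "Lp_norm p \<pi> (\<lambda>z. norm (fst z - snd z)) < wasserstein p \<mu> \<nu> + ennreal e"
    using wasserstein_less_obtain by blast
  note [measurable] = coupling_marginals_measurable[OF \<pi>]
  let ?f = "\<lambda>x::'a. max 0 (norm x - R)"
  have "tail_norm p R \<mu> = Lp_norm p \<pi> (\<lambda>z. ?f (fst z))"
    unfolding tail_norm_def by (subst Lp_norm_coupling(1)[OF \<pi>, symmetric]) auto
  also have "\<dots> \<le> Lp_norm p \<pi> (\<lambda>z. ?f (snd z)) + Lp_norm p \<pi> (\<lambda>z. norm (fst z - snd z))"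
  proof (rule Lp_norm_le_add[OF p])
    have "max 0 (norm x - R) \<le> max 0 (norm y - R) + norm (x - y)" for x y :: 'a
      using norm_triangle_ineq2[of x y] by auto
    then show "AE z in \<pi>. 0 \<le> ?f (fst z) \<and> ?f (fst z) \<le> ?f (snd z) + norm (fst z - snd z)" by simp
  qed auto
  also have "Lp_norm p \<pi> (\<lambda>z. ?f (snd z)) = tail_norm p R \<nu>"
    unfolding tail_norm_def by (rule Lp_norm_coupling(2)[OF \<pi>]) auto
  also have "tail_norm p R \<nu> + Lp_norm p \<pi> (\<lambda>z. norm (fst z - snd z)) \<le> tail_norm p R \<nu> + (wasserstein p \<mu> \<nu> + ennreal e)"
    using less by (intro add_left_mono) auto
  finally show "tail_norm p R \<mu> \<le> tail_norm p R \<nu> + wasserstein p \<mu> \<nu> + ennreal e" by (simp add: add.assoc)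
qed

lemma finite_moment_measures_iff:
  assumes p: "1 \<le> p"
  shows "\<mu> \<in> finite_moment_measures p \<longleftrightarrow> prob_space \<mu> \<and> sets \<mu> = sets borel \<and> Lp_norm p \<mu> norm < \<top>"
proof -
  have "integrable \<mu> (\<lambda>x. norm x powr p) \<longleftrightarrow> (\<integral>\<^sup>+ x. ennreal (norm x powr p) \<partial>\<mu>) < \<top>" if "sets \<mu> = sets borel"
  proof -
    have [measurable_cong]: "sets \<mu> = sets borel" by fact
    show ?thesis by (simp add: integrable_iff_bounded)
  qed
  then show ?thesis using Lp_norm_finite_iff[OF p, of \<mu> norm] by (auto simp: finite_moment_measures_def)
qed

lemma tail_norm_0: "tail_norm p 0 \<mu> = Lp_norm p \<mu> norm"
  by (simp add: tail_norm_def)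

lemma tail_norm_finite:
  assumes p: "1 \<le> p" and \<mu>: "\<mu> \<in> finite_moment_measures p"
  shows "tail_norm p R \<mu> < \<top>"
proof -
  have M: "prob_space \<mu>" "sets \<mu> = sets borel" "Lp_norm p \<mu> norm < \<top>"
    using \<mu> finite_moment_measures_iff[OF p] by auto
  have [measurable_cong]: "sets \<mu> = sets borel" by fact
  have "tail_norm p R \<mu> \<le> Lp_norm p \<mu> norm + Lp_norm p \<mu> (\<lambda>_. \<bar>R\<bar>)"
    unfolding tail_norm_def by (intro Lp_norm_le_add[OF p]) auto
  also have "\<dots> < \<top>" using M p by (simp add: Lp_norm_const)
  finally show ?thesis .
qed

lemma tail_norm_tendsto_0:
  assumes p: "1 \<le> p" and \<mu>: "\<mu> \<in> finite_moment_measures p" and e: "0 < e"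
  obtains R where "0 \<le> R" "tail_norm p R \<mu> \<le> ennreal e"
proof -
  have M: "prob_space \<mu>" "sets \<mu> = sets borel" "Lp_norm p \<mu> norm < \<top>"
    using \<mu> finite_moment_measures_iff[OF p] by auto
  have [measurable_cong]: "sets \<mu> = sets borel" by fact
  let ?f = "\<lambda>k x::'a. max 0 (norm x - real k)"
  have "(\<lambda>k. \<integral>\<^sup>+ x. ennreal (?f k x powr p) \<partial>\<mu>) \<longlonglongrightarrow> (\<integral>\<^sup>+ x. 0 \<partial>\<mu>)"
  proof (rule nn_integral_dominated_convergence[where w="\<lambda>x. ennreal (norm x powr p)"])
    show "(\<integral>\<^sup>+ x. ennreal (norm x powr p) \<partial>\<mu>) < \<infinity>" using M(3) Lp_norm_finite_iff[OF p, of \<mu> norm] by simp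
    show "AE x in \<mu>. ennreal (?f k x powr p) \<le> ennreal (norm x powr p)" for k
      using p by (auto intro!: ennreal_leI powr_mono2)
    show "AE x in \<mu>. (\<lambda>k. ennreal (?f k x powr p)) \<longlonglongrightarrow> 0"
    proof (rule AE_I2)
      fix x :: 'a
      obtain K :: nat where K: "norm x < real K" using reals_Archimedean2 by blast
      have "ennreal (?f k x powr p) = 0" if "K \<le> k" for k
        using K that by simp
      then have "\<forall>\<^sub>F k in sequentially. ennreal (?f k x powr p) = 0" using eventually_sequentially by blast
      then show "(\<lambda>k. ennreal (?f k x powr p)) \<longlonglongrightarrow> 0" by (rule tendsto_eventually)
    qed
  qed auto
  then have "(\<lambda>k. \<integral>\<^sup>+ x. ennreal (?f k x powr p) \<partial>\<mu>) \<longlonglongrightarrow> 0" by simp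
  from order_tendstoD(2)[OF this, of "ennreal (e powr p)"] e
  obtain k where "(\<integral>\<^sup>+ x. ennreal (?f k x powr p) \<partial>\<mu>) < ennreal (e powr p)"
    by (auto simp: eventually_sequentially)
  then show thesis
    using that[of "real k"] e p by (simp add: tail_norm_def Lp_norm_le_iff)
qed

lemma wasserstein_finite:
  fixes \<mu> \<nu> :: "'a::euclidean_space measure"
  assumes p: "1 \<le> p" and \<mu>: "\<mu> \<in> finite_moment_measures p" and \<nu>: "\<nu> \<in> finite_moment_measures p"
  shows "wasserstein p \<mu> \<nu> < \<top>"
proof -
  have M: "prob_space \<mu>" "sets \<mu> = sets borel" "Lp_norm p \<mu> norm < \<top>"
    using \<mu> finite_moment_measures_iff[OF p] by auto
  have N: "prob_space \<nu>" "sets \<nu> = sets borel" "Lp_norm p \<nu> norm < \<top>"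
    using \<nu> finite_moment_measures_iff[OF p] by auto
  have [measurable_cong]: "sets \<mu> = sets borel" "sets \<nu> = sets borel" by fact+
  note D = distr_pair_marginals[OF M(1) N(1)]
  have "wasserstein p \<mu> \<nu> \<le> Lp_norm p (\<mu> \<Otimes>\<^sub>M \<nu>) (\<lambda>w. norm (fst w - snd w))"
    by (intro wasserstein_le_Lp_norm prob_space_pair_measure distr_pair_marginals_borel M(1,2) N(1,2)) measurable
  also have "\<dots> \<le> Lp_norm p (\<mu> \<Otimes>\<^sub>M \<nu>) (\<lambda>w. norm (fst w)) + Lp_norm p (\<mu> \<Otimes>\<^sub>M \<nu>) (\<lambda>w. norm (snd w))"
    by (intro Lp_norm_le_add[OF p]) (auto simp: norm_triangle_ineq4)
  also have "\<dots> = Lp_norm p \<mu> norm + Lp_norm p \<nu> norm"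
    using Lp_norm_distr[of fst "\<mu> \<Otimes>\<^sub>M \<nu>" \<mu> norm p] Lp_norm_distr[of snd "\<mu> \<Otimes>\<^sub>M \<nu>" \<nu> norm p] D by simp
  also have "\<dots> < \<top>" using M N by simp
  finally show ?thesis .
qed

section \<open>Adding independent noise\<close>

text \<open>The base space \<open>N\<close> is arbitrary, so that it can carry a whole coupling to which the same noise is
  added twice.\<close>

lemma distr_add_independent:
  fixes \<mu> \<eta> :: "'a::ordered_euclidean_space measure"
  assumes N: "prob_space N" and [measurable]: "U \<in> N \<rightarrow>\<^sub>M borel" and U: "distr N borel U = \<mu>"
    and \<eta>: "prob_space \<eta>" "sets \<eta> = sets borel"
  shows "distr (N \<Otimes>\<^sub>M \<eta>) borel (\<lambda>w. U (fst w) + snd w) = (\<mu> \<star> \<eta>)"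
proof (rule measure_eqI)
  interpret N: prob_space N by fact
  interpret E: prob_space \<eta> by fact
  have [measurable_cong]: "sets \<eta> = sets borel" by fact
  have mu: "prob_space \<mu>" "sets \<mu> = sets borel" using U N.prob_space_distr[of U borel] by auto
  fix A assume "A \<in> sets (distr (N \<Otimes>\<^sub>M \<eta>) borel (\<lambda>w. U (fst w) + snd w))"
  then have [measurable]: "A \<in> sets borel" by simp
  have "emeasure (distr (N \<Otimes>\<^sub>M \<eta>) borel (\<lambda>w. U (fst w) + snd w)) A = (\<integral>\<^sup>+ w. indicator A (U (fst w) + snd w) \<partial>(N \<Otimes>\<^sub>M \<eta>))"
    using nn_integral_distr[of "\<lambda>w. U (fst w) + snd w" "N \<Otimes>\<^sub>M \<eta>" borel "indicator A"] by simp
  also have "\<dots> = (\<integral>\<^sup>+ u. \<integral>\<^sup>+ z. indicator A (U u + z) \<partial>\<eta> \<partial>N)"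
    by (subst E.nn_integral_fst[symmetric]) auto
  also have "\<dots> = (\<integral>\<^sup>+ x. \<integral>\<^sup>+ z. indicator A (x + z) \<partial>\<eta> \<partial>\<mu>)"
    unfolding U[symmetric] by (subst nn_integral_distr) auto
  also have "\<dots> = emeasure (\<mu> \<star> \<eta>) A"
    using mu(1) by (intro convolution_emeasure'[symmetric] mu(2) \<eta>(2) E.finite_measure_axioms prob_space.finite_measure) simp_all
  finally show "emeasure (distr (N \<Otimes>\<^sub>M \<eta>) borel (\<lambda>w. U (fst w) + snd w)) A = emeasure (\<mu> \<star> \<eta>) A" .
qed simp

lemma distr_pair_add:
  fixes \<mu> \<eta> :: "'a::ordered_euclidean_space measure"
  assumes "prob_space \<mu>" "sets \<mu> = sets borel" "prob_space \<eta>" "sets \<eta> = sets borel"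
  shows "distr (\<mu> \<Otimes>\<^sub>M \<eta>) borel (\<lambda>w. fst w + snd w) = (\<mu> \<star> \<eta>)"
proof -
  have "distr \<mu> borel (\<lambda>x. x) = \<mu>" using assms distr_id2 by metis
  moreover have "(\<lambda>x. x) \<in> \<mu> \<rightarrow>\<^sub>M borel" using assms by (simp cong: measurable_cong_sets)
  ultimately show ?thesis using distr_add_independent[OF assms(1) _ _ assms(3,4), of "\<lambda>x. x"] by simp
qed

lemma prob_space_convolution:
  fixes \<mu> \<eta> :: "'a::ordered_euclidean_space measure"
  assumes "prob_space \<mu>" "sets \<mu> = sets borel" "prob_space \<eta>" "sets \<eta> = sets borel"
  shows "prob_space (\<mu> \<star> \<eta>)"
proof -
  have [measurable_cong]: "sets \<mu> = sets borel" "sets \<eta> = sets borel" by (fact assms)+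
  show ?thesis unfolding distr_pair_add[OF assms, symmetric]
    by (intro prob_space.prob_space_distr prob_space_pair_measure assms) auto
qed

text \<open>The common noise cancels in the difference of the two coupled points.\<close>

lemma wasserstein_convolution_le:
  fixes \<mu> \<nu> \<eta> :: "'a::ordered_euclidean_space measure"
  assumes \<eta>: "prob_space \<eta>" "sets \<eta> = sets borel"
  shows "wasserstein p (\<mu> \<star> \<eta>) (\<nu> \<star> \<eta>) \<le> wasserstein p \<mu> \<nu>"
proof (rule wasserstein_greatest)
  fix \<pi> assume \<pi>: "\<pi> \<in> couplings \<mu> \<nu>"
  note P = couplings_D[OF \<pi>]
  have [measurable_cong]: "sets \<eta> = sets borel" by fact
  note [measurable] = coupling_marginals_measurable[OF \<pi>]
  have "wasserstein p (\<mu> \<star> \<eta>) (\<nu> \<star> \<eta>) \<le> Lp_norm p (\<pi> \<Otimes>\<^sub>M \<eta>) (\<lambda>w. norm ((fst (fst w) + snd w) - (snd (fst w) + snd w)))"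
    using P \<eta> by (intro wasserstein_le_Lp_norm distr_add_independent prob_space_pair_measure) auto
  also have "\<dots> = Lp_norm p \<pi> (\<lambda>z. norm (fst z - snd z))"
    using Lp_norm_distr[of fst "\<pi> \<Otimes>\<^sub>M \<eta>" \<pi> "\<lambda>z. norm (fst z - snd z)" p] distr_pair_marginals[OF P(1) \<eta>(1)] by simp
  finally show "wasserstein p (\<mu> \<star> \<eta>) (\<nu> \<star> \<eta>) \<le> Lp_norm p \<pi> (\<lambda>z. norm (fst z - snd z))" .
qed

text \<open>The coupling of \<open>x\<close> with \<open>x + z\<close> moves mass by exactly the noise \<open>z\<close>.\<close>

lemma wasserstein_self_convolution_le:
  fixes \<mu> \<eta> :: "'a::ordered_euclidean_space measure"
  assumes M: "prob_space \<mu>" "sets \<mu> = sets borel" and \<eta>: "prob_space \<eta>" "sets \<eta> = sets borel"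
  shows "wasserstein p \<mu> (\<mu> \<star> \<eta>) \<le> Lp_norm p \<eta> norm"
proof -
  have [measurable_cong]: "sets \<mu> = sets borel" "sets \<eta> = sets borel" by (fact assms)+
  note D = distr_pair_marginals[OF M(1) \<eta>(1)]
  have "wasserstein p \<mu> (\<mu> \<star> \<eta>) \<le> Lp_norm p (\<mu> \<Otimes>\<^sub>M \<eta>) (\<lambda>w. norm (fst w - (fst w + snd w)))"
    by (intro wasserstein_le_Lp_norm prob_space_pair_measure distr_pair_marginals_borel distr_pair_add M \<eta>) measurable
  also have "\<dots> = Lp_norm p \<eta> norm"
    using Lp_norm_distr[of snd "\<mu> \<Otimes>\<^sub>M \<eta>" \<eta> norm p] D by simp
  finally show ?thesis .
qed

lemma finite_moment_convolution:
  fixes \<mu> \<eta> :: "'a::ordered_euclidean_space measure"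
  assumes p: "1 \<le> p" and \<mu>: "\<mu> \<in> finite_moment_measures p" and \<eta>: "\<eta> \<in> finite_moment_measures p"
  shows "(\<mu> \<star> \<eta>) \<in> finite_moment_measures p"
proof -
  have M: "prob_space \<mu>" "sets \<mu> = sets borel" "Lp_norm p \<mu> norm < \<top>"
    using \<mu> finite_moment_measures_iff[OF p] by auto
  have N: "prob_space \<eta>" "sets \<eta> = sets borel" "Lp_norm p \<eta> norm < \<top>"
    using \<eta> finite_moment_measures_iff[OF p] by auto
  have "Lp_norm p (\<mu> \<star> \<eta>) norm \<le> Lp_norm p \<mu> norm + wasserstein p (\<mu> \<star> \<eta>) \<mu>"
    using tail_norm_le_wasserstein[OF p, of 0 "\<mu> \<star> \<eta>" \<mu>] by (simp add: tail_norm_0)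
  also have "\<dots> \<le> Lp_norm p \<mu> norm + Lp_norm p \<eta> norm"
    using wasserstein_self_convolution_le[OF M(1,2) N(1,2)] by (intro add_left_mono) (simp add: wasserstein_commute)
  also have "\<dots> < \<top>" using M N by simp
  finally show ?thesis using finite_moment_measures_iff[OF p, of "\<mu> \<star> \<eta>"] prob_space_convolution[OF M(1,2) N(1,2)] by simp
qed

text \<open>Noise bounded by \<open>r\<close> decreases the norm of a point by at most \<open>r\<close>. Together with the Lipschitz
  property of the tail norm this transfers tail bounds from smoothed measures to the original ones.\<close>

lemma tail_norm_le_convolution:
  fixes \<mu> \<eta> :: "'a::ordered_euclidean_space measure"
  assumes p: "1 \<le> p" and M: "prob_space \<mu>" "sets \<mu> = sets borel" and \<eta>: "prob_space \<eta>" "sets \<eta> = sets borel"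
    and r: "AE z in \<eta>. norm z \<le> r"
  shows "tail_norm p R \<mu> \<le> tail_norm p (R - r) (\<mu> \<star> \<eta>)"
proof -
  have [measurable_cong]: "sets \<mu> = sets borel" "sets \<eta> = sets borel" by (fact assms)+
  note D = distr_pair_marginals[OF M(1) \<eta>(1)]
  have r': "AE w in \<mu> \<Otimes>\<^sub>M \<eta>. norm (snd w) \<le> r"
  proof (rule AE_distrD[of snd "\<mu> \<Otimes>\<^sub>M \<eta>" \<eta>])
    show "AE z in distr (\<mu> \<Otimes>\<^sub>M \<eta>) \<eta> snd. norm z \<le> r" using r by (simp only: D)
  qed simp
  have "tail_norm p R \<mu> = Lp_norm p (\<mu> \<Otimes>\<^sub>M \<eta>) (\<lambda>w. max 0 (norm (fst w) - R))"
    using Lp_norm_distr[of fst "\<mu> \<Otimes>\<^sub>M \<eta>" \<mu> "\<lambda>x. max 0 (norm x - R)" p] D by (simp add: tail_norm_def)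
  also have "\<dots> \<le> Lp_norm p (\<mu> \<Otimes>\<^sub>M \<eta>) (\<lambda>w. max 0 (norm (fst w + snd w) - (R - r)))"
  proof (rule Lp_norm_mono_AE[OF p])
    show "AE w in \<mu> \<Otimes>\<^sub>M \<eta>. 0 \<le> max 0 (norm (fst w) - R) \<and> max 0 (norm (fst w) - R) \<le> max 0 (norm (fst w + snd w) - (R - r))"
      using r'
    proof eventually_elim
      case (elim w)
      then show ?case using norm_triangle_ineq2[of "fst w" "- snd w"] by auto
    qed
  qed
  also have "\<dots> = tail_norm p (R - r) (\<mu> \<star> \<eta>)"
    unfolding tail_norm_def distr_pair_add[OF M \<eta>, symmetric] by (subst Lp_norm_distr) auto
  finally show ?thesis .
qed

section \<open>Measures with densities\<close>

lemma nn_integral_bool_pair: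
  fixes F :: "bool \<times> 'b \<times> 'c \<Rightarrow> ennreal"
  assumes "sigma_finite_measure L" "sigma_finite_measure N"
    and [measurable]: "F \<in> borel_measurable (count_space UNIV \<Otimes>\<^sub>M (L \<Otimes>\<^sub>M N))"
  shows "(\<integral>\<^sup>+ w. F w \<partial>(count_space UNIV \<Otimes>\<^sub>M (L \<Otimes>\<^sub>M N))) =
    (\<integral>\<^sup>+ x. \<integral>\<^sup>+ y. F (True, x, y) \<partial>N \<partial>L) + (\<integral>\<^sup>+ x. \<integral>\<^sup>+ y. F (False, x, y) \<partial>N \<partial>L)"
proof -
  interpret L: sigma_finite_measure L by fact
  interpret N: sigma_finite_measure N by fact
  interpret LN: pair_sigma_finite L N ..
  have "(\<integral>\<^sup>+ w. F w \<partial>(count_space UNIV \<Otimes>\<^sub>M (L \<Otimes>\<^sub>M N))) = (\<integral>\<^sup>+ b. \<integral>\<^sup>+ z. F (b, z) \<partial>(L \<Otimes>\<^sub>M N) \<partial>count_space UNIV)"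
    by (rule LN.P.nn_integral_fst[symmetric]) simp
  also have "\<dots> = (\<integral>\<^sup>+ z. F (True, z) \<partial>(L \<Otimes>\<^sub>M N)) + (\<integral>\<^sup>+ z. F (False, z) \<partial>(L \<Otimes>\<^sub>M N))"
    by (simp add: nn_integral_count_space_finite UNIV_bool add.commute)
  also have "\<dots> = (\<integral>\<^sup>+ x. \<integral>\<^sup>+ y. F (True, x, y) \<partial>N \<partial>L) + (\<integral>\<^sup>+ x. \<integral>\<^sup>+ y. F (False, x, y) \<partial>N \<partial>L)"
    by (subst (1 2) N.nn_integral_fst[symmetric]) simp_all
  finally show ?thesis .
qed

lemma sets_off_diagonal [measurable]:
  "{z :: 'a::euclidean_space \<times> 'a. fst z \<noteq> snd z} \<in> sets (borel \<Otimes>\<^sub>M borel)"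
proof -
  have "{z \<in> space (borel \<Otimes>\<^sub>M borel :: ('a \<times> 'a) measure). fst z \<noteq> snd z} \<in> sets (borel \<Otimes>\<^sub>M borel)"
    by measurable
  then show ?thesis by (simp add: space_pair_measure)
qed

text \<open>The common mass \<open>min f g\<close> is left in place and only the excess of \<open>f\<close> over \<open>g\<close> is moved, to an
  independent point distributed as the normalised excess of \<open>g\<close> over \<open>f\<close>; both excesses have the same
  mass \<open>\<delta>\<close>. The Boolean coordinate of the auxiliary space records which of the two happens. If \<open>\<delta> = 0\<close>,
  the excess cannot be normalised, but then the measures agree.\<close>

lemma maximal_coupling:
  fixes L :: "'a::euclidean_space measure" and f g :: "'a \<Rightarrow> ennreal"
  assumes "sigma_finite_measure L" and sL: "sets L = sets borel"
    and f[measurable]: "f \<in> borel_measurable borel" and g[measurable]: "g \<in> borel_measurable borel"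
    and pf: "prob_space (density L f)" and pg: "prob_space (density L g)"
  obtains \<pi> where "\<pi> \<in> couplings (density L f) (density L g)"
    "emeasure \<pi> {z. fst z \<noteq> snd z} \<le> (\<integral>\<^sup>+ x. f x - g x \<partial>L)"
proof -
  interpret L: sigma_finite_measure L by fact
  have [measurable_cong]: "sets L = sets borel" by fact
  define m where "m x = min (f x) (g x)" for x
  define a where "a x = f x - m x" for x
  define b where "b x = g x - m x" for x
  define \<delta> where "\<delta> = (\<integral>\<^sup>+ x. a x \<partial>L)"
  have [measurable]: "m \<in> borel_measurable borel" "a \<in> borel_measurable borel" "b \<in> borel_measurable borel"
    unfolding m_def[abs_def] a_def[abs_def] b_def[abs_def] by measurable
  have fa: "f x = a x + m x" and gb: "g x = b x + m x" for x
    by (simp_all add: a_def b_def m_def diff_add_cancel_ennreal)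
  have int_f: "(\<integral>\<^sup>+ x. f x \<partial>L) = 1" and int_g: "(\<integral>\<^sup>+ x. g x \<partial>L) = 1"
    using prob_space.emeasure_space_1[OF pf] prob_space.emeasure_space_1[OF pg]
    by (simp_all add: emeasure_density cong: nn_integral_cong)
  have sum_a: "\<delta> + (\<integral>\<^sup>+ x. m x \<partial>L) = 1"
    unfolding \<delta>_def using int_f by (subst nn_integral_add[symmetric]) (simp_all add: fa)
  have sum_b: "(\<integral>\<^sup>+ x. b x \<partial>L) + (\<integral>\<^sup>+ x. m x \<partial>L) = 1"
    using int_g by (subst nn_integral_add[symmetric]) (simp_all add: gb)
  have m_fin: "(\<integral>\<^sup>+ x. m x \<partial>L) \<noteq> \<top>" using sum_a by auto
  have int_b: "(\<integral>\<^sup>+ x. b x \<partial>L) = \<delta>"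
    using sum_a sum_b m_fin by (metis ennreal_add_diff_cancel_right)
  have \<delta>_fin: "\<delta> \<noteq> \<top>" using sum_a by auto
  have \<delta>_le: "\<delta> \<le> (\<integral>\<^sup>+ x. f x - g x \<partial>L)"
    unfolding \<delta>_def a_def m_def
  proof (rule nn_integral_mono)
    show "f x - min (f x) (g x) \<le> f x - g x" for x
      by (cases "f x = \<top>") (auto simp: min_def top_unique diff_eq_0_ennreal less_top)
  qed
  show thesis
  proof (cases "\<delta> = 0")
    case True
    have "AE x in L. a x = 0"
      using True unfolding \<delta>_def by (subst (asm) nn_integral_0_iff_AE) auto
    moreover have "AE x in L. b x = 0"
      using True int_b[symmetric] by (simp add: nn_integral_0_iff_AE)
    ultimately have "AE x in L. f x = g x" by eventually_elim (simp add: fa gb)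
    then have eq: "density L f = density L g" by (intro density_cong) auto
    let ?\<mu> = "density L f"
    let ?\<pi> = "distr ?\<mu> (borel \<Otimes>\<^sub>M borel) (\<lambda>x. (x, x))"
    have id: "distr ?\<mu> borel (\<lambda>x. x) = ?\<mu>"
      using distr_cong[OF refl, of borel ?\<mu> ?\<mu> "\<lambda>x. x" "\<lambda>x. x"] sL by simp
    have "?\<pi> \<in> couplings ?\<mu> (density L g)"
      unfolding eq[symmetric] using pf id by (intro couplingI) auto
    moreover have "emeasure ?\<pi> {z. fst z \<noteq> snd z} = 0"
      by (subst emeasure_distr) (auto simp: sets_off_diagonal)
    ultimately show thesis using that by simp
  next
    case False
    define \<beta> where "\<beta> = density L (\<lambda>y. b y / \<delta>)"
    have \<beta>_sets[measurable_cong]: "sets \<beta> = sets borel" by (simp add: \<beta>_def sL)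
    have \<beta>_cmult: "\<delta> * (\<integral>\<^sup>+ y. u y \<partial>\<beta>) = (\<integral>\<^sup>+ y. b y * u y \<partial>L)" if [measurable]: "u \<in> borel_measurable borel" for u
    proof -
      have "\<delta> * (\<integral>\<^sup>+ y. u y \<partial>\<beta>) = (\<integral>\<^sup>+ y. \<delta> * (b y / \<delta> * u y) \<partial>L)"
        unfolding \<beta>_def by (simp add: nn_integral_density nn_integral_cmult)
      also have "\<dots> = (\<integral>\<^sup>+ y. b y * u y \<partial>L)"
        using False \<delta>_fin
        by (intro nn_integral_cong)
          (simp add: mult.assoc[symmetric] ennreal_times_divide mult.commute[of \<delta>] ennreal_mult_divide_eq)
      finally show ?thesis .
    qed
    have "\<delta> * emeasure \<beta> (space \<beta>) = \<delta> * 1"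
      using \<beta>_cmult[of "\<lambda>_. 1"] int_b by simp
    then have "emeasure \<beta> (space \<beta>) = 1"
      using False \<delta>_fin by (simp only: ennreal_mult_cancel_left) auto
    then interpret B: prob_space \<beta> by (rule prob_spaceI)
    let ?W = "count_space (UNIV :: bool set) \<Otimes>\<^sub>M (L \<Otimes>\<^sub>M \<beta>)"
    \<comment> \<open>On the branch True the pair stays on the diagonal with density m; on the branch False
      the excess mass of f is sent to an independent point drawn from the excess of g.\<close>
    define D where "D w = (if fst w then m (fst (snd w)) else a (fst (snd w)))" for w :: "bool \<times> 'a \<times> 'a"
    define X :: "bool \<times> 'a \<times> 'a \<Rightarrow> 'a" where "X w = fst (snd w)" for w
    define Y :: "bool \<times> 'a \<times> 'a \<Rightarrow> 'a" where "Y w = (if fst w then fst (snd w) else snd (snd w))" for w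
    have [measurable]: "D \<in> borel_measurable ?W" "X \<in> ?W \<rightarrow>\<^sub>M borel" "Y \<in> ?W \<rightarrow>\<^sub>M borel"
      unfolding D_def[abs_def] X_def[abs_def] Y_def[abs_def] by measurable
    define P where "P = density ?W D"
    have [measurable_cong]: "sets P = sets ?W" by (simp add: P_def)
    have int_P: "(\<integral>\<^sup>+ w. F w \<partial>P) = (\<integral>\<^sup>+ x. \<integral>\<^sup>+ y. m x * F (True, x, y) \<partial>\<beta> \<partial>L) + (\<integral>\<^sup>+ x. \<integral>\<^sup>+ y. a x * F (False, x, y) \<partial>\<beta> \<partial>L)"
      if [measurable]: "F \<in> borel_measurable ?W" for F
      unfolding P_def
      by (subst nn_integral_density, simp, simp,
          subst nn_integral_bool_pair[OF L.sigma_finite_measure_axioms B.sigma_finite_measure_axioms]) (simp_all add: D_def)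
    have X_marg: "distr P borel X = density L f"
    proof (rule measure_eqI)
      fix A assume "A \<in> sets (distr P borel X)"
      then have [measurable]: "A \<in> sets borel" by simp
      have "emeasure (distr P borel X) A = (\<integral>\<^sup>+ w. indicator A (X w) \<partial>P)"
        using nn_integral_distr[of X P borel "indicator A"] by simp
      also have "\<dots> = (\<integral>\<^sup>+ x. m x * indicator A x \<partial>L) + (\<integral>\<^sup>+ x. a x * indicator A x \<partial>L)"
        by (subst int_P) (simp_all add: X_def B.emeasure_space_1)
      also have "\<dots> = (\<integral>\<^sup>+ x. f x * indicator A x \<partial>L)"
        by (subst nn_integral_add[symmetric]) (simp_all add: fa distrib_right add.commute)
      also have "\<dots> = emeasure (density L f) A" by (subst emeasure_density) auto
      finally show "emeasure (distr P borel X) A = emeasure (density L f) A" .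
    qed (simp add: sL)
    have Y_marg: "distr P borel Y = density L g"
    proof (rule measure_eqI)
      fix A assume "A \<in> sets (distr P borel Y)"
      then have [measurable]: "A \<in> sets borel" by simp
      have "emeasure (distr P borel Y) A = (\<integral>\<^sup>+ w. indicator A (Y w) \<partial>P)"
        using nn_integral_distr[of Y P borel "indicator A"] by simp
      also have "\<dots> = (\<integral>\<^sup>+ x. m x * indicator A x \<partial>L) + (\<integral>\<^sup>+ x. a x * (\<integral>\<^sup>+ y. indicator A y \<partial>\<beta>) \<partial>L)"
        by (subst int_P) (simp_all add: Y_def B.emeasure_space_1 nn_integral_cmult)
      also have "(\<integral>\<^sup>+ x. a x * (\<integral>\<^sup>+ y. indicator A y \<partial>\<beta>) \<partial>L) = (\<integral>\<^sup>+ y. b y * indicator A y \<partial>L)"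
        by (subst nn_integral_multc) (simp_all add: \<delta>_def[symmetric] \<beta>_cmult[symmetric])
      also have "(\<integral>\<^sup>+ x. m x * indicator A x \<partial>L) + \<dots> = (\<integral>\<^sup>+ x. g x * indicator A x \<partial>L)"
        by (subst nn_integral_add[symmetric]) (simp_all add: gb distrib_right add.commute)
      also have "\<dots> = emeasure (density L g) A" by (subst emeasure_density) auto
      finally show "emeasure (distr P borel Y) A = emeasure (density L g) A" .
    qed (simp add: sL)
    have "prob_space P" using prob_space_distrD[of X P borel] pf X_marg by simp
    then have coup: "distr P (borel \<Otimes>\<^sub>M borel) (\<lambda>w. (X w, Y w)) \<in> couplings (density L f) (density L g)"
      using X_marg Y_marg by (intro couplingI) auto
    have "emeasure (distr P (borel \<Otimes>\<^sub>M borel) (\<lambda>w. (X w, Y w))) {z. fst z \<noteq> snd z} =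
        emeasure P {w \<in> space P. X w \<noteq> Y w}"
      by (subst emeasure_distr) (auto intro!: arg_cong[where f="emeasure P"] simp: sets_off_diagonal)
    also have "\<dots> \<le> (\<integral>\<^sup>+ w. (if fst w then 0 else 1) \<partial>P)"
    proof -
      have "{w \<in> space P. X w \<noteq> Y w} \<in> sets P" by measurable
      then have "emeasure P {w \<in> space P. X w \<noteq> Y w} = (\<integral>\<^sup>+ w. indicator {w \<in> space P. X w \<noteq> Y w} w \<partial>P)"
        by (rule nn_integral_indicator[symmetric])
      also have "\<dots> \<le> (\<integral>\<^sup>+ w. (if fst w then 0 else 1) \<partial>P)"
        by (intro nn_integral_mono) (auto simp: X_def Y_def split: split_indicator)
      finally show ?thesis .
    qed
    also have "\<dots> = \<delta>"
      by (subst int_P) (simp_all add: \<delta>_def B.emeasure_space_1)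
    finally show thesis using that[OF coup] \<delta>_le by simp
  qed
qed

text \<open>Off the diagonal the distance of two points is at most \<open>2 R\<close> plus the excesses of their norms
  over \<open>R\<close>. A maximal coupling makes the first contribution small.\<close>

lemma wasserstein_density_le:
  fixes L :: "'a::euclidean_space measure" and f g :: "'a \<Rightarrow> ennreal"
  assumes p: "1 \<le> p" and L: "sigma_finite_measure L" "sets L = sets borel"
    and fg: "f \<in> borel_measurable borel" "g \<in> borel_measurable borel"
      "prob_space (density L f)" "prob_space (density L g)"
    and R: "0 \<le> R" and d: "0 \<le> d" "(\<integral>\<^sup>+ x. f x - g x \<partial>L) \<le> ennreal d"
  shows "wasserstein p (density L f) (density L g) \<le>
    ennreal (2 * R * d powr (1 / p)) + (tail_norm p R (density L f) + tail_norm p R (density L g))"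
proof -
  obtain \<pi> where \<pi>: "\<pi> \<in> couplings (density L f) (density L g)"
    and off: "emeasure \<pi> {z. fst z \<noteq> snd z} \<le> (\<integral>\<^sup>+ x. f x - g x \<partial>L)"
    using maximal_coupling[OF L fg] by blast
  note P = couplings_D[OF \<pi>]
  have [measurable_cong]: "sets \<pi> = sets (borel \<Otimes>\<^sub>M borel)" by (rule P)
  note [measurable] = coupling_marginals_measurable[OF \<pi>]
  have off_set: "{z. fst z \<noteq> snd z} \<in> sets \<pi>" by (simp add: P sets_off_diagonal)
  let ?I = "indicator {z. fst z \<noteq> snd z} :: 'a \<times> 'a \<Rightarrow> real"
  let ?t = "\<lambda>x::'a. max 0 (norm x - R)"
  have [measurable]: "?I \<in> borel_measurable \<pi>" using off_set by simp
  have "wasserstein p (density L f) (density L g) \<le> Lp_norm p \<pi> (\<lambda>z. norm (fst z - snd z))"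
    using P by (intro wasserstein_le_Lp_norm) auto
  also have "\<dots> \<le> Lp_norm p \<pi> (\<lambda>z. 2 * R * ?I z) + Lp_norm p \<pi> (\<lambda>z. ?t (fst z) + ?t (snd z))"
  proof (rule Lp_norm_le_add[OF p])
    have "norm (x - y) \<le> 2 * R * ?I (x, y) + (?t x + ?t y)" for x y
      using norm_triangle_ineq4[of x y] by (auto simp: indicator_def)
    then show "AE z in \<pi>. 0 \<le> norm (fst z - snd z) \<and> norm (fst z - snd z) \<le> 2 * R * ?I z + (?t (fst z) + ?t (snd z))"
      by auto
  qed (use R in auto)
  also have "\<dots> \<le> ennreal (2 * R * d powr (1 / p)) + (Lp_norm p \<pi> (\<lambda>z. ?t (fst z)) + Lp_norm p \<pi> (\<lambda>z. ?t (snd z)))"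
  proof (intro add_mono Lp_norm_add_le p)
    have "(\<integral>\<^sup>+ z. ennreal ((2 * R * ?I z) powr p) \<partial>\<pi>) = (\<integral>\<^sup>+ z. ennreal ((2 * R) powr p) * indicator {z. fst z \<noteq> snd z} z \<partial>\<pi>)"
      using p by (intro nn_integral_cong) (auto split: split_indicator)
    also have "\<dots> = ennreal ((2 * R) powr p) * emeasure \<pi> {z. fst z \<noteq> snd z}"
      using off_set by (rule nn_integral_cmult_indicator)
    also have "\<dots> \<le> ennreal ((2 * R) powr p) * ennreal d"
      using off d by (intro mult_left_mono) auto
    also have "\<dots> = ennreal ((2 * R * d powr (1 / p)) powr p)"
      using d R p by (simp add: powr_mult powr_powr ennreal_mult)
    finally show "Lp_norm p \<pi> (\<lambda>z. 2 * R * ?I z) \<le> ennreal (2 * R * d powr (1 / p))"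
      using R d p by (subst Lp_norm_le_iff) auto
  qed auto
  also have "Lp_norm p \<pi> (\<lambda>z. ?t (fst z)) = tail_norm p R (density L f)"
    unfolding tail_norm_def by (rule Lp_norm_coupling(1)[OF \<pi>]) auto
  also have "Lp_norm p \<pi> (\<lambda>z. ?t (snd z)) = tail_norm p R (density L g)"
    unfolding tail_norm_def by (rule Lp_norm_coupling(2)[OF \<pi>]) auto
  finally show ?thesis .
qed

section \<open>Rescaled kernels\<close>

lemma sets_kernel_measure: "sets (kernel_measure \<kappa> \<sigma>) = sets borel"
  by (simp add: kernel_measure_def)

text \<open>Rescaling the density is rescaling the random vector. Moments and supports are read off from this
  description.\<close>

lemma kernel_measure_eq_distr:
  fixes \<kappa> :: "'a::euclidean_space \<Rightarrow> real"
  assumes [measurable]: "\<kappa> \<in> borel_measurable borel" and nn: "\<And>x. 0 \<le> \<kappa> x" and \<sigma>: "0 < \<sigma>"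
  shows "kernel_measure \<kappa> \<sigma> = distr (density lborel (\<lambda>x. ennreal (\<kappa> x))) borel (\<lambda>x. \<sigma> *\<^sub>R x)"
proof (rule measure_eqI)
  fix A assume "A \<in> sets (kernel_measure \<kappa> \<sigma>)"
  then have [measurable]: "A \<in> sets borel" by (simp add: sets_kernel_measure)
  have [measurable]: "rescaled_kernel \<kappa> \<sigma> \<in> borel_measurable borel"
    unfolding rescaled_kernel_def[abs_def] by measurable
  have "emeasure (kernel_measure \<kappa> \<sigma>) A = (\<integral>\<^sup>+ x. ennreal (rescaled_kernel \<kappa> \<sigma> x) * indicator A x \<partial>lborel)"
    unfolding kernel_measure_def by (subst emeasure_density) auto
  also have "\<dots> = (\<integral>\<^sup>+ x. ennreal (\<sigma> ^ DIM('a)) * (ennreal (rescaled_kernel \<kappa> \<sigma> (\<sigma> *\<^sub>R x)) * indicator A (\<sigma> *\<^sub>R x)) \<partial>lborel)"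
    using \<sigma> by (subst lborel_affine[of \<sigma> 0]) (auto simp: nn_integral_density nn_integral_distr)
  also have "\<dots> = (\<integral>\<^sup>+ x. ennreal (\<kappa> x) * indicator A (\<sigma> *\<^sub>R x) \<partial>lborel)"
    using \<sigma> nn by (intro nn_integral_cong)
      (simp add: rescaled_kernel_def mult.assoc[symmetric] ennreal_mult[symmetric])
  also have "\<dots> = emeasure (distr (density lborel (\<lambda>x. ennreal (\<kappa> x))) borel (\<lambda>x. \<sigma> *\<^sub>R x)) A"
    using nn_integral_distr[of "\<lambda>x. \<sigma> *\<^sub>R x" "density lborel (\<lambda>x. ennreal (\<kappa> x))" borel "indicator A"]
    by (simp add: nn_integral_density)
  finally show "emeasure (kernel_measure \<kappa> \<sigma>) A = emeasure (distr (density lborel (\<lambda>x. ennreal (\<kappa> x))) borel (\<lambda>x. \<sigma> *\<^sub>R x)) A" .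
qed (simp add: kernel_measure_def)

lemma prob_space_density_lborel:
  assumes "\<kappa> \<in> borel_measurable borel" "\<And>x. 0 \<le> \<kappa> x" "(\<integral>x. \<kappa> x \<partial>lborel) = 1"
  shows "prob_space (density lborel (\<lambda>x. ennreal (\<kappa> x)))"
proof -
  have "integrable lborel \<kappa>" using assms(3) not_integrable_integral_eq by fastforce
  then have "(\<integral>\<^sup>+ x. ennreal (\<kappa> x) \<partial>lborel) = 1" using assms by (subst nn_integral_eq_integral) auto
  then show ?thesis using assms(1) by (intro prob_spaceI) (simp add: emeasure_density cong: nn_integral_cong)
qed

lemma kernel_measure_finite_moment:
  fixes \<kappa> :: "'a::euclidean_space \<Rightarrow> real"
  assumes p: "1 \<le> p" and meas[measurable]: "\<kappa> \<in> borel_measurable borel" and nn: "\<And>x. 0 \<le> \<kappa> x"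
    and int: "(\<integral>x. \<kappa> x \<partial>lborel) = 1" and \<sigma>: "0 < \<sigma>"
  shows "prob_space (kernel_measure \<kappa> \<sigma>)"
    "Lp_norm p (kernel_measure \<kappa> \<sigma>) norm \<le> ennreal \<sigma> * Lp_norm p (density lborel (\<lambda>x. ennreal (\<kappa> x))) norm"
proof -
  show "prob_space (kernel_measure \<kappa> \<sigma>)"
    unfolding kernel_measure_eq_distr[OF meas nn \<sigma>]
    by (intro prob_space.prob_space_distr prob_space_density_lborel meas nn int) auto
  have "Lp_norm p (kernel_measure \<kappa> \<sigma>) norm = Lp_norm p (density lborel (\<lambda>x. ennreal (\<kappa> x))) (\<lambda>x. \<sigma> * norm x)"
    unfolding kernel_measure_eq_distr[OF meas nn \<sigma>] using \<sigma> by (subst Lp_norm_distr) auto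
  also have "\<dots> \<le> ennreal \<sigma> * Lp_norm p (density lborel (\<lambda>x. ennreal (\<kappa> x))) norm"
    using p \<sigma> by (intro Lp_norm_cmult_le) auto
  finally show "Lp_norm p (kernel_measure \<kappa> \<sigma>) norm \<le> ennreal \<sigma> * Lp_norm p (density lborel (\<lambda>x. ennreal (\<kappa> x))) norm" .
qed

lemma C_infinity_continuous: "C_infinity \<kappa> \<Longrightarrow> continuous_on UNIV \<kappa>"
  unfolding C_infinity_def by (metis C_k.simps(1))

lemma smoothing_kernel_properties:
  fixes \<kappa> :: "'a::euclidean_space \<Rightarrow> real"
  assumes \<kappa>: "smoothing_kernel \<kappa>" and \<sigma>: "0 < \<sigma>" and p: "1 \<le> p"
  shows "kernel_measure \<kappa> \<sigma> \<in> finite_moment_measures p"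
    and "\<exists>r. 0 \<le> r \<and> (AE z in kernel_measure \<kappa> \<sigma>. norm z \<le> r)"
proof -
  have meas[measurable]: "\<kappa> \<in> borel_measurable borel"
    using \<kappa> by (auto simp: smoothing_kernel_def intro!: borel_measurable_continuous_onI C_infinity_continuous)
  have nn: "\<And>x. 0 \<le> \<kappa> x" and int: "(\<integral>x. \<kappa> x \<partial>lborel) = 1"
    using \<kappa> by (auto simp: smoothing_kernel_def)
  have "bounded {x. \<kappa> x \<noteq> 0}"
    using \<kappa> bounded_subset[OF compact_imp_bounded closure_subset, of "{x. \<kappa> x \<noteq> 0}"] by (simp add: smoothing_kernel_def)
  then obtain r0 where r0: "\<And>x. \<kappa> x \<noteq> 0 \<Longrightarrow> norm x \<le> r0" "0 < r0"
    unfolding bounded_pos by auto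
  have r: "AE z in kernel_measure \<kappa> \<sigma>. norm z \<le> \<sigma> * r0"
    unfolding kernel_measure_eq_distr[OF meas nn \<sigma>]
    using \<sigma> r0 by (subst AE_distr_iff) (auto simp: AE_density intro!: AE_I2 mult_left_mono)
  then show "\<exists>r. 0 \<le> r \<and> (AE z in kernel_measure \<kappa> \<sigma>. norm z \<le> r)"
    using r0 \<sigma> by (intro exI[of _ "\<sigma> * r0"]) auto
  show "kernel_measure \<kappa> \<sigma> \<in> finite_moment_measures p"
  proof -
    have "Lp_norm p (kernel_measure \<kappa> \<sigma>) norm \<le> Lp_norm p (kernel_measure \<kappa> \<sigma>) (\<lambda>_. \<sigma> * r0)"
      using r by (intro Lp_norm_mono_AE p) auto
    also have "\<dots> < \<top>"
      using p r0 \<sigma> kernel_measure_finite_moment(1)[OF p meas nn int \<sigma>] by (simp add: Lp_norm_const)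
    finally show ?thesis
      using kernel_measure_finite_moment(1)[OF p meas nn int \<sigma>] finite_moment_measures_iff[OF p, of "kernel_measure \<kappa> \<sigma>"]
      by (simp add: sets_kernel_measure)
  qed
qed

section \<open>The Gaussian kernel\<close>

text \<open>As a product over the coordinates, it reduces to the one-dimensional normal density by Fubini.\<close>

definition gaussian :: "'a::euclidean_space \<Rightarrow> real"
  where "gaussian x = (\<Prod>b\<in>Basis. std_normal_density (x \<bullet> b))"

abbreviation gaussian_measure :: "'a::euclidean_space measure"
  where "gaussian_measure \<equiv> density lborel (\<lambda>x. ennreal (gaussian x))"

lemma gaussian_measurable [measurable]: "gaussian \<in> borel_measurable borel"
  unfolding gaussian_def[abs_def] by measurable

lemma gaussian_nonneg: "0 \<le> gaussian x"
  unfolding gaussian_def by (intro prod_nonneg) auto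

lemma integral_lborel_prod:
  fixes f :: "'a::euclidean_space \<Rightarrow> real \<Rightarrow> 'b::{real_normed_field, banach, second_countable_topology}"
  assumes int: "\<And>b. b \<in> Basis \<Longrightarrow> integrable lborel (f b)"
  shows "(\<integral>x. (\<Prod>b\<in>Basis. f b (x \<bullet> b)) \<partial>lborel) = (\<Prod>b\<in>Basis. \<integral>x. f b x \<partial>lborel)"
proof -
  interpret product_sigma_finite "\<lambda>_::'a. lborel :: real measure" ..
  have [measurable]: "f b \<in> borel_measurable borel" if "b \<in> Basis" for b
    using borel_measurable_integrable[OF int[OF that]] by simp
  have "(\<integral>x. (\<Prod>b\<in>Basis. f b (x \<bullet> b)) \<partial>lborel) =
      (\<integral>y. (\<Prod>b\<in>Basis. f b ((\<Sum>c\<in>Basis. y c *\<^sub>R c) \<bullet> b)) \<partial>(\<Pi>\<^sub>M b\<in>(Basis::'a set). lborel))"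
    by (subst lborel_eq, subst integral_distr) simp_all
  also have "\<dots> = (\<integral>y. (\<Prod>b\<in>Basis. f b (y b)) \<partial>(\<Pi>\<^sub>M b\<in>(Basis::'a set). lborel))"
    by (intro Bochner_Integration.integral_cong refl prod.cong) simp_all
  also have "\<dots> = (\<Prod>b\<in>Basis. \<integral>x. f b x \<partial>lborel)"
    by (intro product_integral_prod int) simp_all
  finally show ?thesis .
qed

lemma integral_gaussian: "(\<integral>x. gaussian x \<partial>(lborel :: 'a::euclidean_space measure)) = 1"
  using integral_lborel_prod[of "\<lambda>(_::'a). std_normal_density"] integrable_normal_density[of 1 0]
    integral_normal_density[of 1 0]
  by (simp add: gaussian_def)

lemma prob_space_gaussian: "prob_space (gaussian_measure :: 'a::euclidean_space measure)"
  by (intro prob_space_density_lborel gaussian_measurable gaussian_nonneg integral_gaussian)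

text \<open>The norm is at most the sum of the absolute coordinates, and by Minkowski each of them can be treated
  alone. Real powers are compared with an even integer power, whose normal moments are finite.\<close>

lemma gaussian_finite_moment:
  assumes p: "1 \<le> p"
  shows "Lp_norm p (gaussian_measure :: 'a::euclidean_space measure) norm < \<top>"
proof -
  let ?G = "gaussian_measure :: 'a measure"
  have coord: "Lp_norm p ?G (\<lambda>x. \<bar>x \<bullet> b\<bar>) < \<top>" if b: "b \<in> Basis" for b
  proof -
    obtain k :: nat where k: "p \<le> real k" using real_arch_simple by blast
    define h where "h c t = (if c = b then \<bar>t\<bar> powr p else 1) * std_normal_density t" for c t
    have "(\<integral>\<^sup>+ t. ennreal (\<bar>t\<bar> powr p * std_normal_density t) \<partial>lborel) \<le>
        (\<integral>\<^sup>+ t. ennreal (std_normal_density t + std_normal_density t * t ^ (2 * k)) \<partial>lborel)"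
    proof (intro nn_integral_mono ennreal_leI)
      fix t :: real
      have "\<bar>t\<bar> powr p \<le> 1 + t ^ (2 * k)"
      proof (cases "\<bar>t\<bar> \<le> 1")
        case True
        then have "\<bar>t\<bar> powr p \<le> 1 powr p" using p by (intro powr_mono2) auto
        then show ?thesis by (simp add: add_increasing2)
      next
        case False
        then have "\<bar>t\<bar> powr p \<le> \<bar>t\<bar> powr real (2 * k)" using k p by (intro powr_mono) auto
        also have "\<dots> = t ^ (2 * k)" using False by (subst powr_realpow) (auto simp: power_mult)
        finally show ?thesis by simp
      qed
      then have "std_normal_density t * \<bar>t\<bar> powr p \<le> std_normal_density t * (1 + t ^ (2 * k))"
        by (intro mult_left_mono) auto
      then show "\<bar>t\<bar> powr p * std_normal_density t \<le> std_normal_density t + std_normal_density t * t ^ (2 * k)"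
        by (simp add: algebra_simps)
    qed
    also have "\<dots> < \<infinity>"
    proof -
      have "integrable lborel (\<lambda>t. std_normal_density t + std_normal_density t * t ^ (2 * k))"
        using integrable_std_normal_moment by (intro Bochner_Integration.integrable_add) auto
      then show ?thesis by (subst nn_integral_eq_integral) auto
    qed
    finally have fin: "(\<integral>\<^sup>+ t. ennreal (\<bar>t\<bar> powr p * std_normal_density t) \<partial>lborel) < \<top>" by simp
    have "(\<integral>\<^sup>+ x. ennreal (\<bar>x \<bullet> b\<bar> powr p) \<partial>?G) = (\<integral>\<^sup>+ x. (\<Prod>c\<in>Basis. ennreal (h c (x \<bullet> c))) \<partial>lborel)"
      using b by (subst nn_integral_density)
        (auto simp: gaussian_def h_def prod.distrib prod.delta prod_ennreal ennreal_mult[symmetric] mult.commute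
          prod_nonneg intro!: nn_integral_cong)
    also have "\<dots> = (\<Prod>c\<in>Basis. \<integral>\<^sup>+ t. ennreal (h c t) \<partial>lborel)"
      by (intro nn_integral_lborel_prod) (auto simp: h_def[abs_def])
    also have "\<dots> < \<top>"
    proof -
      have "(\<integral>\<^sup>+ t. ennreal (std_normal_density t) \<partial>lborel) = 1"
        using integrable_normal_density[of 1 0] integral_normal_density[of 1 0]
        by (subst nn_integral_eq_integral) auto
      then have "(\<integral>\<^sup>+ t. ennreal (h c t) \<partial>lborel) < \<top>" for c
        using fin by (cases "c = b") (auto simp: h_def)
      then show ?thesis by (simp add: less_top[symmetric] ennreal_prod_eq_top)
    qed
    finally show ?thesis using Lp_norm_finite_iff[OF p, of ?G "\<lambda>x. \<bar>x \<bullet> b\<bar>"] by simp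
  qed
  have sums: "Lp_norm p ?G (\<lambda>x. \<Sum>b\<in>B. \<bar>x \<bullet> b\<bar>) < \<top>" if "finite B" "B \<subseteq> Basis" for B
    using that
  proof (induction B rule: finite_induct)
    case empty
    then show ?case using p by (simp add: Lp_norm_def ennreal_powr_def)
  next
    case (insert b B)
    have "Lp_norm p ?G (\<lambda>x. \<bar>x \<bullet> b\<bar> + (\<Sum>b\<in>B. \<bar>x \<bullet> b\<bar>)) \<le> Lp_norm p ?G (\<lambda>x. \<bar>x \<bullet> b\<bar>) + Lp_norm p ?G (\<lambda>x. \<Sum>b\<in>B. \<bar>x \<bullet> b\<bar>)"
      by (intro Lp_norm_add_le p) (auto intro!: sum_nonneg)
    also have "\<dots> < \<top>" using insert coord[of b] by simp
    finally show ?case using insert by simp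
  qed
  have "Lp_norm p ?G norm \<le> Lp_norm p ?G (\<lambda>x. \<Sum>b\<in>Basis. \<bar>x \<bullet> b\<bar>)"
    by (intro Lp_norm_mono p norm_le_l1) auto
  also have "\<dots> < \<top>" by (intro sums) auto
  finally show ?thesis .
qed

lemma cis_measurable [measurable (raw)]:
  "f \<in> borel_measurable M \<Longrightarrow> (\<lambda>x. cis (f x)) \<in> borel_measurable M"
  by (rule measurable_compose[of f M borel cis]) (auto intro!: borel_measurable_continuous_onI continuous_intros)

text \<open>Up to a constant the Gaussian density is its own Fourier transform. This is what expresses a
  mollified density by characteristic functions.\<close>

lemma gaussian_fourier:
  fixes x :: "'a::euclidean_space"
  shows "complex_of_real (gaussian x) = of_real ((1 / sqrt (2 * pi)) ^ DIM('a)) * (\<integral>t. cis (t \<bullet> x) \<partial>gaussian_measure)"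
proof -
  have one: "(\<integral>s. complex_of_real (std_normal_density s) * cis (s * u) \<partial>lborel) = of_real (exp (- (u\<^sup>2) / 2))" for u
  proof -
    have "(\<integral>s. complex_of_real (std_normal_density s) * cis (s * u) \<partial>lborel) = (\<integral>s. cis (s * u) \<partial>std_normal_distribution)"
      by (subst integral_density) (auto simp: scaleR_conv_of_real)
    also have "\<dots> = char std_normal_distribution u"
      unfolding char_def by (simp add: cis_conv_exp mult.commute)
    finally show ?thesis by (simp add: char_std_normal_distribution)
  qed
  have "(\<integral>t. cis (t \<bullet> x) \<partial>gaussian_measure) = (\<integral>t. gaussian t *\<^sub>R cis (t \<bullet> x) \<partial>lborel)"
    by (subst integral_density) (auto simp: gaussian_nonneg)
  also have "\<dots> = (\<integral>t. (\<Prod>b\<in>Basis. complex_of_real (std_normal_density (t \<bullet> b)) * cis ((t \<bullet> b) * (x \<bullet> b))) \<partial>lborel)"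
  proof (intro Bochner_Integration.integral_cong refl)
    fix t :: 'a
    have "cis (t \<bullet> x) = (\<Prod>b\<in>Basis. cis ((t \<bullet> b) * (x \<bullet> b)))"
      unfolding euclidean_inner[of t x] by (simp add: cis_conv_exp exp_sum sum_distrib_left)
    then show "gaussian t *\<^sub>R cis (t \<bullet> x) = (\<Prod>b\<in>Basis. complex_of_real (std_normal_density (t \<bullet> b)) * cis ((t \<bullet> b) * (x \<bullet> b)))"
      by (simp add: gaussian_def scaleR_conv_of_real prod.distrib)
  qed
  also have "\<dots> = (\<Prod>b\<in>Basis. \<integral>s. complex_of_real (std_normal_density s) * cis (s * (x \<bullet> b)) \<partial>lborel)"
  proof (rule integral_lborel_prod)
    fix b :: 'a
    show "integrable lborel (\<lambda>s. complex_of_real (std_normal_density s) * cis (s * (x \<bullet> b)))"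
      by (rule Bochner_Integration.integrable_bound[OF integrable_normal_density[of 1 0]]) (auto simp: norm_mult)
  qed
  also have "\<dots> = of_real (\<Prod>b\<in>(Basis::'a set). exp (- ((x \<bullet> b)\<^sup>2) / 2))"
    by (simp only: one of_real_prod)
  finally have "(\<integral>t. cis (t \<bullet> x) \<partial>gaussian_measure) = of_real (\<Prod>b\<in>(Basis::'a set). exp (- ((x \<bullet> b)\<^sup>2) / 2))" .
  moreover have "gaussian x = (1 / sqrt (2 * pi)) ^ DIM('a) * (\<Prod>b\<in>(Basis::'a set). exp (- ((x \<bullet> b)\<^sup>2) / 2))"
    unfolding gaussian_def std_normal_density_def by (simp only: prod.distrib prod_constant)
  ultimately show ?thesis by simp
qed

section \<open>Characteristic functions\<close>

definition char_fun :: "'a::euclidean_space measure \<Rightarrow> 'a \<Rightarrow> complex"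
  where "char_fun \<mu> t = (\<integral>x. cis (t \<bullet> x) \<partial>\<mu>)"

lemma char_fun_0: "prob_space \<mu> \<Longrightarrow> char_fun \<mu> 0 = 1"
  by (simp add: char_fun_def prob_space.prob_space)

lemma integrable_cis:
  assumes "prob_space M" "f \<in> borel_measurable M"
  shows "integrable M (\<lambda>x. cis (f x))"
proof -
  interpret prob_space M by fact
  show ?thesis using assms(2) by (intro integrable_const_bound[where B=1]) auto
qed

lemma norm_char_fun_le_1:
  assumes "prob_space \<mu>" "sets \<mu> = sets borel"
  shows "norm (char_fun \<mu> t) \<le> 1"
proof -
  interpret prob_space \<mu> by fact
  have "norm (char_fun \<mu> t) \<le> (\<integral>x. norm (cis (t \<bullet> x)) \<partial>\<mu>)"
    unfolding char_fun_def by (rule integral_norm_bound)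
  then show ?thesis by (simp add: prob_space)
qed

lemma norm_cis_diff_le: "norm (cis a - cis b) \<le> \<bar>a - b\<bar>"
proof -
  have "norm (cis a - cis b) = norm (cis b * (cis (a - b) - 1))"
    by (simp add: algebra_simps cis_mult)
  also have "\<dots> = norm (cis (a - b) - 1)" by (simp add: norm_mult)
  also have "\<dots> \<le> \<bar>a - b\<bar>"
    using iexp_approx1[of "a - b" 0] by (simp add: cis_conv_exp)
  finally show ?thesis .
qed

lemma char_fun_diff_le_wasserstein:
  assumes p: "1 \<le> p" and W: "wasserstein p \<mu> \<nu> < ennreal s"
  shows "norm (char_fun \<mu> t - char_fun \<nu> t) \<le> norm t * s"
  unfolding char_fun_def
proof (rule integral_lipschitz_diff_le[OF p W, where B = 1])
  show "norm (cis (t \<bullet> x) - cis (t \<bullet> y)) \<le> norm t * norm (x - y)" for x y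
    using norm_cis_diff_le[of "t \<bullet> x" "t \<bullet> y"] Cauchy_Schwarz_ineq2[of t "x - y"]
    by (simp add: inner_diff_right)
qed auto

text \<open>The modulus of continuity depends only on a bound for the moment, hence is uniform along
  a sequence with bounded moments.\<close>

lemma char_fun_equicontinuous:
  assumes p: "1 \<le> p" and M: "prob_space \<mu>" "sets \<mu> = sets borel" and C: "0 \<le> C" "Lp_norm p \<mu> norm \<le> ennreal C"
  shows "norm (char_fun \<mu> t - char_fun \<mu> s) \<le> norm (t - s) * C"
proof -
  have [measurable_cong]: "sets \<mu> = sets borel" by (rule M)
  have int: "integrable \<mu> (\<lambda>x. cis (t \<bullet> x))" for t by (intro integrable_cis M) simp
  have "ennreal (norm (char_fun \<mu> t - char_fun \<mu> s)) = ennreal (norm (\<integral>x. cis (t \<bullet> x) - cis (s \<bullet> x) \<partial>\<mu>))"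
    unfolding char_fun_def using int by simp
  also have "\<dots> \<le> (\<integral>\<^sup>+ x. ennreal (norm (cis (t \<bullet> x) - cis (s \<bullet> x))) \<partial>\<mu>)"
    using int by (intro integral_norm_bound_ennreal) auto
  also have "\<dots> \<le> (\<integral>\<^sup>+ x. ennreal (norm (t - s)) * ennreal (norm x) \<partial>\<mu>)"
  proof (rule nn_integral_mono)
    fix x
    have "norm (cis (t \<bullet> x) - cis (s \<bullet> x)) \<le> norm (t - s) * norm x"
      using norm_cis_diff_le[of "t \<bullet> x" "s \<bullet> x"] Cauchy_Schwarz_ineq2[of "t - s" x]
      by (simp add: inner_diff_left)
    then show "ennreal (norm (cis (t \<bullet> x) - cis (s \<bullet> x))) \<le> ennreal (norm (t - s)) * ennreal (norm x)"
      by (simp add: ennreal_mult[symmetric] ennreal_leI)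
  qed
  also have "\<dots> \<le> ennreal (norm (t - s)) * Lp_norm p \<mu> norm"
    by (subst nn_integral_cmult) (auto intro!: mult_left_mono nn_integral_le_Lp_norm p M)
  also have "\<dots> \<le> ennreal (norm (t - s)) * ennreal C" by (intro mult_left_mono C) auto
  also have "\<dots> = ennreal (norm (t - s) * C)" using C by (simp add: ennreal_mult)
  finally show ?thesis using C by simp
qed

lemma char_fun_convolution:
  fixes \<mu> \<eta> :: "'a::ordered_euclidean_space measure"
  assumes M: "prob_space \<mu>" "sets \<mu> = sets borel" and E: "prob_space \<eta>" "sets \<eta> = sets borel"
  shows "char_fun (\<mu> \<star> \<eta>) t = char_fun \<mu> t * char_fun \<eta> t"
proof -
  have [measurable_cong]: "sets \<mu> = sets borel" "sets \<eta> = sets borel" by (fact M E)+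
  interpret M: prob_space \<mu> by (rule M)
  interpret E: prob_space \<eta> by (rule E)
  interpret P: pair_prob_space \<mu> \<eta> ..
  have "char_fun (\<mu> \<star> \<eta>) t = (\<integral>w. cis (t \<bullet> (fst w + snd w)) \<partial>(\<mu> \<Otimes>\<^sub>M \<eta>))"
    unfolding char_fun_def distr_pair_add[OF M E, symmetric] by (subst integral_distr) auto
  also have "\<dots> = (\<integral>x. \<integral>z. cis (t \<bullet> (x + z)) \<partial>\<eta> \<partial>\<mu>)"
    using integrable_cis[OF P.prob_space_axioms, of "\<lambda>w. t \<bullet> (fst w + snd w)"]
    by (subst P.integral_fst'[symmetric]) simp_all
  also have "\<dots> = (\<integral>x. cis (t \<bullet> x) * char_fun \<eta> t \<partial>\<mu>)"
    by (simp add: char_fun_def inner_add_right cis_mult[symmetric])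
  also have "\<dots> = char_fun \<mu> t * char_fun \<eta> t" by (simp add: char_fun_def)
  finally show ?thesis .
qed

section \<open>Gaussian mollification\<close>

text \<open>The Lebesgue density of the convolution with the Gaussian of width \<open>\<tau>\<close>, see
  \<open>convolution_gaussian_eq_density\<close>.\<close>

definition mollified_density :: "real \<Rightarrow> 'a::euclidean_space measure \<Rightarrow> 'a \<Rightarrow> real"
  where "mollified_density \<tau> \<mu> x = (\<integral>y. rescaled_kernel gaussian \<tau> (x - y) \<partial>\<mu>)"

lemma rescaled_gaussian_measurable [measurable]: "rescaled_kernel gaussian \<tau> \<in> borel_measurable borel"
  unfolding rescaled_kernel_def[abs_def] by measurable

lemma rescaled_gaussian_fourier:
  fixes x :: "'a::euclidean_space"
  shows "complex_of_real (rescaled_kernel gaussian \<tau> x) =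
    of_real ((1 / sqrt (2 * pi)) ^ DIM('a) / \<tau> ^ DIM('a)) * (\<integral>t. cis ((t /\<^sub>R \<tau>) \<bullet> x) \<partial>gaussian_measure)"
  unfolding rescaled_kernel_def of_real_divide gaussian_fourier by (simp add: ac_simps)

lemma rescaled_gaussian_bound:
  fixes x :: "'a::euclidean_space"
  assumes "0 < \<tau>"
  shows "\<bar>rescaled_kernel gaussian \<tau> x\<bar> \<le> (1 / sqrt (2 * pi)) ^ DIM('a) / \<tau> ^ DIM('a)"
proof -
  interpret G: prob_space "gaussian_measure :: 'a measure" by (rule prob_space_gaussian)
  let ?c = "(1 / sqrt (2 * pi)) ^ DIM('a) / \<tau> ^ DIM('a)"
  have "norm (\<integral>t. cis ((t /\<^sub>R \<tau>) \<bullet> x) \<partial>gaussian_measure) \<le> (\<integral>t. norm (cis ((t /\<^sub>R \<tau>) \<bullet> x)) \<partial>(gaussian_measure :: 'a measure))"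
    by (rule integral_norm_bound)
  then have le1: "norm (\<integral>t. cis ((t /\<^sub>R \<tau>) \<bullet> x) \<partial>gaussian_measure) \<le> 1" by (simp add: G.prob_space[simplified])
  have c0: "0 \<le> ?c" using assms by simp
  have "\<bar>rescaled_kernel gaussian \<tau> x\<bar> = norm (complex_of_real (rescaled_kernel gaussian \<tau> x))" by simp
  also have "\<dots> = ?c * norm (\<integral>t. cis ((t /\<^sub>R \<tau>) \<bullet> x) \<partial>gaussian_measure)"
    unfolding rescaled_gaussian_fourier norm_mult norm_of_real using c0 by (simp only: abs_of_nonneg)
  also have "\<dots> \<le> ?c * 1" by (intro mult_left_mono le1 c0)
  finally show ?thesis by simp
qed

lemma integrable_rescaled_gaussian:
  fixes \<mu> :: "'a::euclidean_space measure"
  assumes "prob_space \<mu>" "sets \<mu> = sets borel" "0 < \<tau>"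
  shows "integrable \<mu> (\<lambda>y. rescaled_kernel gaussian \<tau> (x - y))"
proof -
  interpret prob_space \<mu> by fact
  have [measurable_cong]: "sets \<mu> = sets borel" by fact
  show ?thesis
    using rescaled_gaussian_bound[OF \<open>0 < \<tau>\<close>]
    by (intro integrable_const_bound[where B="(1 / sqrt (2 * pi)) ^ DIM('a) / \<tau> ^ DIM('a)"]) auto
qed

text \<open>Inserting the Fourier representation of the Gaussian and exchanging the integrals leaves the
  characteristic function of \<open>\<mu>\<close>, integrated against a finite measure.\<close>

lemma mollified_density_fourier:
  fixes \<mu> :: "'a::euclidean_space measure"
  assumes M: "prob_space \<mu>" "sets \<mu> = sets borel" and \<tau>: "0 < \<tau>"
  shows "complex_of_real (mollified_density \<tau> \<mu> x) =
    of_real ((1 / sqrt (2 * pi)) ^ DIM('a) / \<tau> ^ DIM('a)) *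
      (\<integral>t. cis ((t /\<^sub>R \<tau>) \<bullet> x) * char_fun \<mu> (- (t /\<^sub>R \<tau>)) \<partial>gaussian_measure)"
proof -
  let ?G = "gaussian_measure :: 'a measure" and ?c = "(1 / sqrt (2 * pi)) ^ DIM('a) / \<tau> ^ DIM('a)"
  interpret M: prob_space \<mu> by (rule M)
  interpret G: prob_space ?G by (rule prob_space_gaussian)
  interpret P: pair_prob_space \<mu> ?G ..
  have [measurable_cong]: "sets \<mu> = sets borel" by (rule M)
  have "complex_of_real (mollified_density \<tau> \<mu> x) = (\<integral>y. complex_of_real (rescaled_kernel gaussian \<tau> (x - y)) \<partial>\<mu>)"
    unfolding mollified_density_def by (rule integral_complex_of_real[symmetric])
  also have "\<dots> = of_real ?c * (\<integral>y. \<integral>t. cis ((t /\<^sub>R \<tau>) \<bullet> (x - y)) \<partial>?G \<partial>\<mu>)"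
    unfolding rescaled_gaussian_fourier by (rule integral_mult_right_zero)
  also have "(\<integral>y. \<integral>t. cis ((t /\<^sub>R \<tau>) \<bullet> (x - y)) \<partial>?G \<partial>\<mu>) = (\<integral>t. \<integral>y. cis ((t /\<^sub>R \<tau>) \<bullet> (x - y)) \<partial>\<mu> \<partial>?G)"
    using integrable_cis[OF P.prob_space_axioms, of "\<lambda>(y, t). (t /\<^sub>R \<tau>) \<bullet> (x - y)"]
    by (intro P.Fubini_integral[symmetric]) (simp add: case_prod_beta')
  also have "\<dots> = (\<integral>t. cis ((t /\<^sub>R \<tau>) \<bullet> x) * char_fun \<mu> (- (t /\<^sub>R \<tau>)) \<partial>?G)"
  proof -
    have "cis (u \<bullet> (x - y)) = cis (u \<bullet> x) * cis (- u \<bullet> y)" for u y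
      by (simp add: cis_mult inner_diff_right)
    then show ?thesis by (simp only: char_fun_def integral_mult_right_zero)
  qed
  finally show ?thesis .
qed

lemma char_fun_measurable [measurable]:
  fixes \<mu> :: "'a::euclidean_space measure"
  assumes M: "prob_space \<mu>" "sets \<mu> = sets borel"
  shows "char_fun \<mu> \<in> borel_measurable borel"
proof -
  interpret prob_space \<mu> by (rule M)
  have [measurable_cong]: "sets \<mu> = sets borel" by (rule M)
  show ?thesis unfolding char_fun_def[abs_def] by measurable
qed

text \<open>Dominated convergence under the Gaussian measure: characteristic functions are bounded by 1.\<close>

lemma mollified_density_tendsto:
  fixes \<mu> :: "'a::euclidean_space measure"
  assumes M: "prob_space \<mu>" "sets \<mu> = sets borel" and N: "\<And>n. prob_space (\<nu> n)" "\<And>n. sets (\<nu> n) = sets borel"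
    and \<tau>: "0 < \<tau>" and lim: "\<And>t. (\<lambda>n. char_fun (\<nu> n) t) \<longlonglongrightarrow> char_fun \<mu> t"
  shows "(\<lambda>n. mollified_density \<tau> (\<nu> n) x) \<longlonglongrightarrow> mollified_density \<tau> \<mu> x"
proof -
  let ?G = "gaussian_measure :: 'a measure"
  interpret G: prob_space ?G by (rule prob_space_gaussian)
  note [measurable] = char_fun_measurable[OF M] char_fun_measurable[OF N]
  have "(\<lambda>n. \<integral>t. cis ((t /\<^sub>R \<tau>) \<bullet> x) * char_fun (\<nu> n) (- (t /\<^sub>R \<tau>)) \<partial>?G) \<longlonglongrightarrow>
      (\<integral>t. cis ((t /\<^sub>R \<tau>) \<bullet> x) * char_fun \<mu> (- (t /\<^sub>R \<tau>)) \<partial>?G)"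
    using lim norm_char_fun_le_1[OF N]
    by (intro integral_dominated_convergence[where w="\<lambda>_. 1"]) (auto intro!: tendsto_mult_left simp: norm_mult)
  then have "(\<lambda>n. complex_of_real (mollified_density \<tau> (\<nu> n) x)) \<longlonglongrightarrow> complex_of_real (mollified_density \<tau> \<mu> x)"
    unfolding mollified_density_fourier[OF M \<tau>] mollified_density_fourier[OF N \<tau>] by (intro tendsto_mult_left)
  then show ?thesis by (simp only: tendsto_of_real_iff)
qed

lemma mollified_density_measurable:
  fixes \<mu> :: "'a::euclidean_space measure"
  assumes M: "prob_space \<mu>" "sets \<mu> = sets borel"
  shows "mollified_density \<tau> \<mu> \<in> borel_measurable borel"
proof -
  interpret prob_space \<mu> by (rule M)
  have [measurable_cong]: "sets \<mu> = sets borel" by (rule M)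
  show ?thesis unfolding mollified_density_def[abs_def] by measurable
qed

lemma rescaled_gaussian_nonneg: "0 < \<tau> \<Longrightarrow> 0 \<le> rescaled_kernel gaussian \<tau> x"
  by (simp add: rescaled_kernel_def gaussian_nonneg)

lemma convolution_gaussian_eq_density:
  fixes \<mu> :: "'a::ordered_euclidean_space measure"
  assumes M: "prob_space \<mu>" "sets \<mu> = sets borel" and \<tau>: "0 < \<tau>"
  shows "\<mu> \<star> kernel_measure gaussian \<tau> = density lborel (\<lambda>x. ennreal (mollified_density \<tau> \<mu> x))"
proof (rule measure_eqI)
  interpret M: prob_space \<mu> by (rule M)
  interpret P: pair_sigma_finite \<mu> "lborel :: 'a measure" ..
  have [measurable_cong]: "sets \<mu> = sets borel" by (rule M)
  note [measurable] = mollified_density_measurable[OF M, of \<tau>]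
  interpret K: prob_space "kernel_measure gaussian \<tau> :: 'a measure"
    by (intro kernel_measure_finite_moment(1)[of 1] gaussian_nonneg integral_gaussian \<tau>) auto
  let ?g = "rescaled_kernel gaussian \<tau> :: 'a \<Rightarrow> real"
  fix A assume "A \<in> sets (\<mu> \<star> kernel_measure gaussian \<tau>)"
  then have [measurable]: "A \<in> sets borel" by simp
  have "emeasure (\<mu> \<star> kernel_measure gaussian \<tau>) A = (\<integral>\<^sup>+ y. \<integral>\<^sup>+ z. indicator A (y + z) \<partial>kernel_measure gaussian \<tau> \<partial>\<mu>)"
    by (intro convolution_emeasure' M(2) sets_kernel_measure M.finite_measure_axioms K.finite_measure_axioms) simp
  also have "\<dots> = (\<integral>\<^sup>+ y. \<integral>\<^sup>+ z. ennreal (?g z) * indicator A (y + z) \<partial>lborel \<partial>\<mu>)"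
    unfolding kernel_measure_def by (simp add: nn_integral_density)
  also have "\<dots> = (\<integral>\<^sup>+ y. \<integral>\<^sup>+ x. ennreal (?g (x - y)) * indicator A x \<partial>lborel \<partial>\<mu>)"
  proof (rule nn_integral_cong)
    fix y :: 'a
    have "(\<integral>\<^sup>+ x. ennreal (?g (x - y)) * indicator A x \<partial>lborel) = (\<integral>\<^sup>+ x. ennreal (?g (x - y)) * indicator A x \<partial>distr lborel borel ((+) y))"
      by (simp only: lborel_distr_plus)
    also have "\<dots> = (\<integral>\<^sup>+ z. ennreal (?g z) * indicator A (y + z) \<partial>lborel)"
      by (subst nn_integral_distr) simp_all
    finally show "(\<integral>\<^sup>+ z. ennreal (?g z) * indicator A (y + z) \<partial>lborel) = (\<integral>\<^sup>+ x. ennreal (?g (x - y)) * indicator A x \<partial>lborel)" ..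
  qed
  also have "\<dots> = (\<integral>\<^sup>+ x. \<integral>\<^sup>+ y. ennreal (?g (x - y)) * indicator A x \<partial>\<mu> \<partial>lborel)"
    by (intro P.Fubini'[symmetric]) (simp add: case_prod_beta')
  also have "\<dots> = (\<integral>\<^sup>+ x. ennreal (mollified_density \<tau> \<mu> x) * indicator A x \<partial>lborel)"
  proof (rule nn_integral_cong)
    fix x :: 'a
    have "(\<integral>\<^sup>+ y. ennreal (?g (x - y)) \<partial>\<mu>) = ennreal (mollified_density \<tau> \<mu> x)"
      unfolding mollified_density_def
      by (intro nn_integral_eq_integral integrable_rescaled_gaussian M \<tau>) (simp add: rescaled_gaussian_nonneg \<tau>)
    then show "(\<integral>\<^sup>+ y. ennreal (?g (x - y)) * indicator A x \<partial>\<mu>) = ennreal (mollified_density \<tau> \<mu> x) * indicator A x"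
      by (simp add: nn_integral_multc)
  qed
  also have "\<dots> = emeasure (density lborel (\<lambda>x. ennreal (mollified_density \<tau> \<mu> x))) A"
    by (subst emeasure_density) auto
  finally show "emeasure (\<mu> \<star> kernel_measure gaussian \<tau>) A = emeasure (density lborel (\<lambda>x. ennreal (mollified_density \<tau> \<mu> x))) A" .
qed simp

section \<open>Removing compactly supported noise\<close>

text \<open>For fixed \<open>t\<close> the function \<open>s \<mapsto> char_fun \<eta> (s t)\<close> extends to complex \<open>s\<close>: boundedness of the support
  bounds the moments of \<open>t \<bullet> z\<close> geometrically, so the exponential series may be integrated term by term.
  The extension is 1 at 0, hence its zero at \<open>s = 1\<close>, if there is one, is isolated.\<close>

lemma char_fun_nonzero_dense:
  fixes \<eta> :: "'a::euclidean_space measure"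
  assumes E: "prob_space \<eta>" "sets \<eta> = sets borel" and r: "0 \<le> r" "AE z in \<eta>. norm z \<le> r" and e: "0 < e"
  obtains s where "norm (s - t) < e" "char_fun \<eta> s \<noteq> 0"
proof (cases "char_fun \<eta> t = 0")
  case False
  then show thesis using that[of t] e by simp
next
  case zero: True
  interpret prob_space \<eta> by (rule E)
  have [measurable_cong]: "sets \<eta> = sets borel" by (rule E)
  define C where "C = norm t * r"
  have C: "AE z in \<eta>. norm (t \<bullet> z) \<le> C"
    using r(2)
  proof eventually_elim
    case (elim z)
    then show ?case
      using Cauchy_Schwarz_ineq2[of t z] mult_left_mono[of "norm z" r "norm t"] by (simp add: C_def)
  qed
  define F where "F w = (\<integral>z. exp (\<i> * complex_of_real (t \<bullet> z) * w) \<partial>\<eta>)" for w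
  define a where "a k = (\<integral>z. (\<i> * complex_of_real (t \<bullet> z)) ^ k /\<^sub>R fact k \<partial>\<eta>)" for k
  have sums: "(\<lambda>k. a k * (w - 0) ^ k) sums F w" for w
  proof -
    define f where "f k z = (\<i> * complex_of_real (t \<bullet> z) * w) ^ k /\<^sub>R fact k" for k z
    have [measurable]: "f k \<in> borel_measurable \<eta>" for k unfolding f_def[abs_def] by measurable
    have bound: "AE z in \<eta>. norm (f k z) \<le> (C * norm w) ^ k /\<^sub>R fact k" for k
      using C
    proof eventually_elim
      case (elim z)
      then have "norm (\<i> * complex_of_real (t \<bullet> z) * w) \<le> C * norm w"
        by (simp add: norm_mult mult_right_mono)
      then show ?case by (simp add: f_def norm_power power_mono divide_right_mono)
    qed
    have int: "integrable \<eta> (f k)" for k by (rule integrable_const_bound[OF bound]) simp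
    have "(\<lambda>k. integral\<^sup>L \<eta> (f k)) sums (\<integral>z. (\<Sum>k. f k z) \<partial>\<eta>)"
    proof (rule sums_integral)
      show "AE z in \<eta>. summable (\<lambda>k. norm (f k z))"
        unfolding f_def using summable_norm_exp by auto
      show "summable (\<lambda>k. \<integral>z. norm (f k z) \<partial>\<eta>)"
      proof (rule summable_comparison_test')
        show "summable (\<lambda>k. (C * norm w) ^ k /\<^sub>R fact k)" by (rule summable_exp_generic)
        show "norm (\<integral>z. norm (f k z) \<partial>\<eta>) \<le> (C * norm w) ^ k /\<^sub>R fact k" for k
          using integral_le_const[OF integrable_norm[OF int] bound] by simp
      qed
    qed (rule int)
    moreover have "(\<Sum>k. f k z) = exp (\<i> * complex_of_real (t \<bullet> z) * w)" for z
      by (simp add: f_def exp_def)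
    moreover have "integral\<^sup>L \<eta> (f k) = a k * (w - 0) ^ k" for k
    proof -
      have "f k = (\<lambda>z. ((\<i> * complex_of_real (t \<bullet> z)) ^ k /\<^sub>R fact k) * w ^ k)"
        by (auto simp: f_def power_mult_distrib)
      then show ?thesis by (simp only: a_def integral_mult_left_zero diff_zero)
    qed
    ultimately show ?thesis by (simp add: F_def)
  qed
  have hol: "F holomorphic_on ball 0 2"
    using sums by (intro power_series_holomorphic) auto
  have F_real: "F (of_real s) = char_fun \<eta> (s *\<^sub>R t)" for s
    by (simp add: F_def char_fun_def cis_conv_exp mult_ac)
  have F0: "F 0 \<noteq> 0" using F_real[of 0] char_fun_0[OF E(1)] by simp
  have F1: "F 1 = 0" using F_real[of 1] zero by simp
  have in_ball: "1 \<in> ball (0::complex) 2" "0 \<in> ball (0::complex) 2" by auto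
  obtain d where d: "0 < d" "\<And>z. z \<in> ball 1 d - {1} \<Longrightarrow> F z \<noteq> 0"
    using isolated_zeros[OF hol open_ball convex_connected[OF convex_ball] in_ball(1) F1 in_ball(2) F0] by metis
  \<comment> \<open>A real point next to 1 inside the zero-free disc, so close that \<open>(1 + u) t\<close> is within \<open>e\<close> of \<open>t\<close>.\<close>
  define u where "u = min (d / 2) (e / (2 * (norm t + 1)))"
  have u: "0 < u" "u < d" "u * norm t < e"
  proof -
    have nt: "0 < 2 * (norm t + 1)" by (simp add: add_nonneg_pos)
    show "0 < u" "u < d" using d(1) divide_pos_pos[OF e nt] unfolding u_def by linarith+
    have "u * norm t \<le> e / (2 * (norm t + 1)) * norm t" by (intro mult_right_mono) (auto simp: u_def)
    also have "\<dots> < e"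
      using e nt mult_nonneg_nonneg[of e "norm t"] by (simp add: pos_divide_less_eq algebra_simps del: mult_nonneg_nonneg)
    finally show "u * norm t < e" .
  qed
  have "F (of_real (1 + u)) \<noteq> 0" using u by (intro d) (auto simp: dist_norm)
  then have "char_fun \<eta> ((1 + u) *\<^sub>R t) \<noteq> 0" unfolding F_real .
  moreover have "norm ((1 + u) *\<^sub>R t - t) < e" using u by (simp add: scaleR_left_distrib)
  ultimately show thesis using that by blast
qed

text \<open>At a nearby frequency \<open>s\<close> where the characteristic function of the noise does not vanish, it can be
  divided out of the smoothed characteristic functions. The uniform modulus of continuity leads back
  from \<open>s\<close> to \<open>t\<close>.\<close>

lemma char_fun_tendsto_of_smoothed:
  fixes \<mu> \<eta> :: "'a::ordered_euclidean_space measure"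
  assumes p: "1 \<le> p"
    and M: "prob_space \<mu>" "sets \<mu> = sets borel" "Lp_norm p \<mu> norm \<le> ennreal C"
    and N: "\<And>n. prob_space (\<nu> n)" "\<And>n. sets (\<nu> n) = sets borel"
      "\<forall>\<^sub>F n in sequentially. Lp_norm p (\<nu> n) norm \<le> ennreal C"
    and E: "prob_space \<eta>" "sets \<eta> = sets borel" and r: "0 \<le> r" "AE z in \<eta>. norm z \<le> r" and C: "0 \<le> C"
    and W: "(\<lambda>n. wasserstein p (\<nu> n \<star> \<eta>) (\<mu> \<star> \<eta>)) \<longlonglongrightarrow> 0"
  shows "(\<lambda>n. char_fun (\<nu> n) t) \<longlonglongrightarrow> char_fun \<mu> t"
proof (rule tendstoI)
  fix e :: real assume e: "0 < e"
  have "0 < e / (3 * (C + 1))" using e C by simp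
  then obtain s where s: "norm (s - t) < e / (3 * (C + 1))" "char_fun \<eta> s \<noteq> 0"
    using char_fun_nonzero_dense[OF E r] by metis
  have "norm (t - s) * C \<le> e / (3 * (C + 1)) * C"
    using s C by (intro mult_right_mono) (auto simp: norm_minus_commute)
  also have "\<dots> < e / 3" using e C by (simp add: field_simps)
  finally have close: "norm (t - s) * C < e / 3" .
  have "(\<lambda>n. char_fun (\<nu> n \<star> \<eta>) s) \<longlonglongrightarrow> char_fun (\<mu> \<star> \<eta>) s"
  proof (rule tendstoI)
    fix d :: real assume d: "0 < d"
    define w where "w = d / (norm s + 1)"
    have w: "0 < w" "norm s * w < d" using d by (auto simp: w_def field_simps add_pos_nonneg)
    have "\<forall>\<^sub>F n in sequentially. wasserstein p (\<nu> n \<star> \<eta>) (\<mu> \<star> \<eta>) < ennreal w"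
      using order_tendstoD(2)[OF W, of "ennreal w"] w by simp
    then show "\<forall>\<^sub>F n in sequentially. dist (char_fun (\<nu> n \<star> \<eta>) s) (char_fun (\<mu> \<star> \<eta>) s) < d"
    proof eventually_elim
      case (elim n)
      from char_fun_diff_le_wasserstein[OF p this, of s] w show ?case by (simp add: dist_norm)
    qed
  qed
  then have "(\<lambda>n. char_fun (\<nu> n) s * char_fun \<eta> s) \<longlonglongrightarrow> char_fun \<mu> s * char_fun \<eta> s"
    by (simp only: char_fun_convolution[OF M(1,2) E] char_fun_convolution[OF N(1,2) E])
  then have "(\<lambda>n. char_fun (\<nu> n) s * char_fun \<eta> s / char_fun \<eta> s) \<longlonglongrightarrow> char_fun \<mu> s * char_fun \<eta> s / char_fun \<eta> s"
    using s by (intro tendsto_divide tendsto_const)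
  then have "(\<lambda>n. char_fun (\<nu> n) s) \<longlonglongrightarrow> char_fun \<mu> s" using s by simp
  from tendstoD[OF this, of "e / 3"] e
  have "\<forall>\<^sub>F n in sequentially. dist (char_fun (\<nu> n) s) (char_fun \<mu> s) < e / 3" by simp
  with N(3) show "\<forall>\<^sub>F n in sequentially. dist (char_fun (\<nu> n) t) (char_fun \<mu> t) < e"
  proof eventually_elim
    case (elim n)
    have 1: "dist (char_fun (\<nu> n) t) (char_fun (\<nu> n) s) < e / 3"
      using char_fun_equicontinuous[OF p N(1,2)[of n] C elim(1), of t s] close by (simp add: dist_norm)
    have 2: "dist (char_fun \<mu> s) (char_fun \<mu> t) < e / 3"
      using char_fun_equicontinuous[OF p M(1,2) C M(3), of t s] close by (simp add: dist_norm norm_minus_commute)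
    show ?case
      using dist_triangle[of "char_fun (\<nu> n) t" "char_fun \<mu> t" "char_fun (\<nu> n) s"]
        dist_triangle[of "char_fun (\<nu> n) s" "char_fun \<mu> t" "char_fun \<mu> s"] 1 2 elim(2) by linarith
  qed
qed

text \<open>The argument of Scheffe's lemma: the positive part of the limit density minus the approximating
  one is dominated by the limit density, which is integrable, so pointwise convergence suffices.\<close>

lemma mollified_density_deficit_tendsto_0:
  fixes \<mu> :: "'a::ordered_euclidean_space measure"
  assumes M: "prob_space \<mu>" "sets \<mu> = sets borel" and N: "\<And>n. prob_space (\<nu> n)" "\<And>n. sets (\<nu> n) = sets borel"
    and \<tau>: "0 < \<tau>" and lim: "\<And>t. (\<lambda>n. char_fun (\<nu> n) t) \<longlonglongrightarrow> char_fun \<mu> t"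
  shows "(\<lambda>n. \<integral>\<^sup>+ x. ennreal (mollified_density \<tau> \<mu> x) - ennreal (mollified_density \<tau> (\<nu> n) x) \<partial>lborel) \<longlonglongrightarrow> 0"
proof -
  note [measurable] = mollified_density_measurable[OF M, of \<tau>] mollified_density_measurable[OF N, of \<tau>]
  have nonneg: "0 \<le> mollified_density \<tau> \<rho> x" for \<rho> :: "'a measure" and x
    unfolding mollified_density_def by (intro Bochner_Integration.integral_nonneg) (simp add: rescaled_gaussian_nonneg \<tau>)
  interpret K: prob_space "kernel_measure gaussian \<tau> :: 'a measure"
    by (intro kernel_measure_finite_moment(1)[of 1] gaussian_nonneg integral_gaussian \<tau>) auto
  interpret D: prob_space "density lborel (\<lambda>x. ennreal (mollified_density \<tau> \<mu> x))"
    using prob_space_convolution[OF M K.prob_space_axioms sets_kernel_measure] convolution_gaussian_eq_density[OF M \<tau>] by simp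
  have "(\<lambda>n. \<integral>\<^sup>+ x. ennreal (mollified_density \<tau> \<mu> x) - ennreal (mollified_density \<tau> (\<nu> n) x) \<partial>lborel) \<longlonglongrightarrow> (\<integral>\<^sup>+ x. 0 \<partial>(lborel :: 'a measure))"
  proof (rule nn_integral_dominated_convergence[where w="\<lambda>x. ennreal (mollified_density \<tau> \<mu> x)"])
    show "(\<integral>\<^sup>+ x. ennreal (mollified_density \<tau> \<mu> x) \<partial>lborel) < \<infinity>"
      using D.emeasure_space_1 by (simp add: emeasure_density cong: nn_integral_cong)
    show "AE x in lborel. ennreal (mollified_density \<tau> \<mu> x) - ennreal (mollified_density \<tau> (\<nu> n) x) \<le> ennreal (mollified_density \<tau> \<mu> x)" for n
      by (auto simp: diff_le_self_ennreal)
    show "AE x in lborel. (\<lambda>n. ennreal (mollified_density \<tau> \<mu> x) - ennreal (mollified_density \<tau> (\<nu> n) x)) \<longlonglongrightarrow> 0"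
    proof (rule AE_I2)
      fix x :: 'a
      have "(\<lambda>n. mollified_density \<tau> \<mu> x - mollified_density \<tau> (\<nu> n) x) \<longlonglongrightarrow> mollified_density \<tau> \<mu> x - mollified_density \<tau> \<mu> x"
        by (intro tendsto_diff tendsto_const mollified_density_tendsto M N \<tau> lim)
      then have "(\<lambda>n. ennreal (mollified_density \<tau> \<mu> x - mollified_density \<tau> (\<nu> n) x)) \<longlonglongrightarrow> ennreal 0"
        by (intro tendsto_ennrealI) simp
      then show "(\<lambda>n. ennreal (mollified_density \<tau> \<mu> x) - ennreal (mollified_density \<tau> (\<nu> n) x)) \<longlonglongrightarrow> 0"
        by (simp add: ennreal_minus nonneg)
    qed
  qed auto
  then show ?thesis by simp
qed

text \<open>Mollifying at width \<open>\<tau>\<close> costs at most \<open>e\<close> at each end of the chain from \<open>\<nu> n\<close> over \<open>\<nu> n \<star> \<gamma>\<close> and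
  \<open>\<mu> \<star> \<gamma>\<close> to \<open>\<mu>\<close>. The middle link is bounded by \<open>wasserstein_density_le\<close>: by \<open>e\<close> for the total variation and
  by \<open>2 e + 3 e\<close> for the two tails.\<close>

lemma wasserstein_tendsto_of_smoothed:
  fixes \<mu> \<eta> :: "'a::ordered_euclidean_space measure"
  assumes p: "1 \<le> p"
    and \<mu>: "\<mu> \<in> finite_moment_measures p" and \<nu>: "\<And>n. \<nu> n \<in> finite_moment_measures p"
    and \<eta>: "\<eta> \<in> finite_moment_measures p" and r: "0 \<le> r" "AE z in \<eta>. norm z \<le> r"
    and W: "(\<lambda>n. wasserstein p (\<nu> n \<star> \<eta>) (\<mu> \<star> \<eta>)) \<longlonglongrightarrow> 0" and e: "0 < e"
  shows "\<forall>\<^sub>F n in sequentially. wasserstein p (\<nu> n) \<mu> \<le> ennreal (8 * e)"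
proof -
  have M: "prob_space \<mu>" "sets \<mu> = sets borel"
    using \<mu> finite_moment_measures_iff[OF p] by auto
  have N: "prob_space (\<nu> n)" "sets (\<nu> n) = sets borel" for n
    using \<nu> finite_moment_measures_iff[OF p] by auto
  have E: "prob_space \<eta>" "sets \<eta> = sets borel"
    using \<eta> finite_moment_measures_iff[OF p] by auto
  note \<mu>\<eta> = finite_moment_convolution[OF p \<mu> \<eta>]
  have small: "\<forall>\<^sub>F n in sequentially. wasserstein p (\<nu> n \<star> \<eta>) (\<mu> \<star> \<eta>) < ennreal d" if "0 < d" for d
    using order_tendstoD(2)[OF W, of "ennreal d"] that by simp
  have tail: "tail_norm p (R + r) (\<nu> n) \<le> tail_norm p R (\<mu> \<star> \<eta>) + wasserstein p (\<nu> n \<star> \<eta>) (\<mu> \<star> \<eta>)" for R n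
    using tail_norm_le_convolution[OF p N[of n] E r(2), of "R + r"] tail_norm_le_wasserstein[OF p, of R "\<nu> n \<star> \<eta>" "\<mu> \<star> \<eta>"]
    by simp
  \<comment> \<open>With the radius \<open>- r\<close> the tail bound becomes a bound on the moments of \<open>\<nu> n\<close> around the origin.\<close>
  obtain K where K: "0 \<le> K" "tail_norm p (- r) (\<mu> \<star> \<eta>) = ennreal K"
    using tail_norm_finite[OF p \<mu>\<eta>, of "- r"] by (metis ennreal_cases less_irrefl top_neq_ennreal)
  have lim: "(\<lambda>n. char_fun (\<nu> n) t) \<longlonglongrightarrow> char_fun \<mu> t" for t
  proof (rule char_fun_tendsto_of_smoothed[OF p M _ N _ E r _ W, where C = "K + 1"])
    have "Lp_norm p \<mu> norm \<le> ennreal K"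
      using tail_norm_le_convolution[OF p M E r(2), of 0] K by (simp add: tail_norm_0)
    also have "\<dots> \<le> ennreal (K + 1)" by (intro ennreal_leI) simp
    finally show "Lp_norm p \<mu> norm \<le> ennreal (K + 1)" .
    show "\<forall>\<^sub>F n in sequentially. Lp_norm p (\<nu> n) norm \<le> ennreal (K + 1)"
      using small[OF zero_less_one]
    proof eventually_elim
      case (elim n)
      have "Lp_norm p (\<nu> n) norm \<le> ennreal K + wasserstein p (\<nu> n \<star> \<eta>) (\<mu> \<star> \<eta>)"
        using tail[of "- r" n] K by (simp add: tail_norm_0)
      also have "\<dots> \<le> ennreal K + ennreal 1" using elim by (intro add_left_mono) auto
      finally show ?case using K by simp
    qed
  qed (use K in auto)
  let ?G = "gaussian_measure :: 'a measure"
  obtain m where m: "0 \<le> m" "Lp_norm p ?G norm = ennreal m"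
    using gaussian_finite_moment[OF p, where 'a='a] by (metis ennreal_cases less_irrefl top_neq_ennreal)
  \<comment> \<open>The factor \<open>m\<close> is the \<open>L\<^sup>p\<close> norm of the standard Gaussian, which scales with the width.\<close>
  define \<tau> where "\<tau> = e / (m + 1)"
  have \<tau>: "0 < \<tau>" "\<tau> * m \<le> e" using e m by (auto simp: \<tau>_def field_simps)
  define \<gamma> where "\<gamma> = (kernel_measure gaussian \<tau> :: 'a measure)"
  have G: "prob_space \<gamma>" "sets \<gamma> = sets borel"
    unfolding \<gamma>_def by (intro kernel_measure_finite_moment(1)[of 1] sets_kernel_measure gaussian_nonneg integral_gaussian \<tau>; simp)+
  have "Lp_norm p \<gamma> norm \<le> ennreal \<tau> * ennreal m"
    using kernel_measure_finite_moment(2)[OF p gaussian_measurable gaussian_nonneg integral_gaussian \<tau>(1), where 'a='a] m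
    by (simp add: \<gamma>_def)
  also have "\<dots> \<le> ennreal e" using \<tau> m by (simp add: ennreal_mult[symmetric] ennreal_leI)
  finally have \<gamma>_norm: "Lp_norm p \<gamma> norm \<le> ennreal e" .
  have moll: "wasserstein p \<rho> (\<rho> \<star> \<gamma>) \<le> ennreal e" if "prob_space \<rho>" "sets \<rho> = sets borel" for \<rho>
    using wasserstein_self_convolution_le[OF that G] \<gamma>_norm by (rule order_trans)
  obtain R0 where R0: "0 \<le> R0" "tail_norm p R0 (\<mu> \<star> \<eta>) \<le> ennreal e"
    using tail_norm_tendsto_0[OF p \<mu>\<eta> e] .
  define R where "R = R0 + r"
  have R: "0 \<le> R" using R0 r by (simp add: R_def)
  have "tail_norm p R \<mu> \<le> ennreal e"
    using tail_norm_le_convolution[OF p M E r(2), of R] R0(2) by (simp add: R_def)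
  then have tail_\<mu>: "tail_norm p R (\<mu> \<star> \<gamma>) \<le> ennreal e + ennreal e"
    using tail_norm_le_wasserstein[OF p, of R "\<mu> \<star> \<gamma>" \<mu>] moll[OF M]
    by (meson add_mono order_trans wasserstein_commute_le)
  \<comment> \<open>The total variation that \<open>wasserstein_density_le\<close> tolerates at radius \<open>R\<close>.\<close>
  define d where "d = (e / (2 * R + 1)) powr p"
  have d: "0 < d" "2 * R * d powr (1 / p) \<le> e"
    using e R p by (auto simp: d_def powr_powr field_simps)
  have "\<forall>\<^sub>F n in sequentially. (\<integral>\<^sup>+ x. ennreal (mollified_density \<tau> \<mu> x) - ennreal (mollified_density \<tau> (\<nu> n) x) \<partial>lborel) < ennreal d"
    using order_tendstoD(2)[OF mollified_density_deficit_tendsto_0[OF M N \<tau>(1) lim], of "ennreal d"] d by simp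
  with small[OF e] show ?thesis
  proof eventually_elim
    case (elim n)
    note dens = convolution_gaussian_eq_density[OF M \<tau>(1), folded \<gamma>_def] convolution_gaussian_eq_density[OF N \<tau>(1), of n, folded \<gamma>_def]
    have "tail_norm p R (\<nu> n) \<le> ennreal e + ennreal e"
      using order_trans[OF tail[of R0 n] add_mono[OF R0(2) less_imp_le[OF elim(1)]]] by (simp only: R_def)
    then have tail_\<nu>: "tail_norm p R (\<nu> n \<star> \<gamma>) \<le> (ennreal e + ennreal e) + ennreal e"
      using tail_norm_le_wasserstein[OF p, of R "\<nu> n \<star> \<gamma>" "\<nu> n"] moll[OF N]
      by (meson add_mono order_trans wasserstein_commute_le)
    have "wasserstein p (\<mu> \<star> \<gamma>) (\<nu> n \<star> \<gamma>) \<le>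
        ennreal (2 * R * d powr (1 / p)) + (tail_norm p R (\<mu> \<star> \<gamma>) + tail_norm p R (\<nu> n \<star> \<gamma>))"
      unfolding dens
    proof (rule wasserstein_density_le[OF p])
      show "prob_space (density lborel (\<lambda>x. ennreal (mollified_density \<tau> \<mu> x)))"
        "prob_space (density lborel (\<lambda>x. ennreal (mollified_density \<tau> (\<nu> n) x)))"
        using prob_space_convolution[OF M G] prob_space_convolution[OF N G, of n] dens by simp_all
      note [measurable] = mollified_density_measurable[OF M, of \<tau>] mollified_density_measurable[OF N[of n], of \<tau>]
      show "(\<lambda>x. ennreal (mollified_density \<tau> \<mu> x)) \<in> borel_measurable borel"
        "(\<lambda>x. ennreal (mollified_density \<tau> (\<nu> n) x)) \<in> borel_measurable borel"
        by measurable
    qed (use R d elim(2) in \<open>auto intro: lborel.sigma_finite_measure_axioms\<close>)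
    also have "\<dots> \<le> ennreal e + ((ennreal e + ennreal e) + ((ennreal e + ennreal e) + ennreal e))"
      by (intro add_mono tail_\<mu> tail_\<nu> ennreal_leI d)
    also have "\<dots> = ennreal (6 * e)"
      using e by (simp add: ennreal_plus[symmetric] del: ennreal_plus)
    finally have mid: "wasserstein p (\<nu> n \<star> \<gamma>) (\<mu> \<star> \<gamma>) \<le> ennreal (6 * e)"
      by (simp add: wasserstein_commute)
    have "wasserstein p (\<nu> n) \<mu> \<le> wasserstein p (\<nu> n) (\<nu> n \<star> \<gamma>) + wasserstein p (\<nu> n \<star> \<gamma>) \<mu>"
      by (rule wasserstein_triangle[OF p])
    also have "\<dots> \<le> wasserstein p (\<nu> n) (\<nu> n \<star> \<gamma>) + (wasserstein p (\<nu> n \<star> \<gamma>) (\<mu> \<star> \<gamma>) + wasserstein p (\<mu> \<star> \<gamma>) \<mu>)"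
      by (intro add_left_mono wasserstein_triangle[OF p])
    also have "\<dots> \<le> ennreal e + (ennreal (6 * e) + ennreal e)"
      using moll[OF M] by (intro add_mono moll N mid) (simp add: wasserstein_commute)
    also have "\<dots> = ennreal (8 * e)"
      using e by (simp add: ennreal_plus[symmetric] del: ennreal_plus)
    finally show ?case .
  qed
qed

text \<open>The constant \<open>s\<close> depends on \<open>\<mu>\<close>: the argument by contradiction along a sequence compares with a fixed limit. That is
  exactly the form in which neighbourhoods of \<open>\<mu>\<close> are compared in the two topologies.\<close>

lemma wasserstein_small_of_smoothed_small:
  fixes \<mu> \<eta> :: "'a::ordered_euclidean_space measure"
  assumes p: "1 \<le> p"
    and \<mu>: "\<mu> \<in> finite_moment_measures p"
    and \<eta>: "\<eta> \<in> finite_moment_measures p" and r: "0 \<le> r" "AE z in \<eta>. norm z \<le> r" and e: "0 < e"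
  obtains s where "0 < s" "\<And>\<nu>. \<nu> \<in> finite_moment_measures p \<Longrightarrow>
    wasserstein p (\<mu> \<star> \<eta>) (\<nu> \<star> \<eta>) < ennreal s \<Longrightarrow> wasserstein p \<mu> \<nu> < ennreal e"
proof (rule ccontr)
  assume "\<not> thesis"
  with that have "\<exists>\<nu>\<in>finite_moment_measures p. wasserstein p (\<mu> \<star> \<eta>) (\<nu> \<star> \<eta>) < ennreal s \<and> \<not> wasserstein p \<mu> \<nu> < ennreal e"
    if "0 < s" for s using \<open>0 < s\<close> by blast
  then have "\<forall>n. \<exists>\<nu>\<in>finite_moment_measures p. wasserstein p (\<mu> \<star> \<eta>) (\<nu> \<star> \<eta>) < ennreal (inverse (real (Suc n))) \<and> \<not> wasserstein p \<mu> \<nu> < ennreal e"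
    by simp
  then obtain \<nu> where \<nu>: "\<And>n. \<nu> n \<in> finite_moment_measures p"
    "\<And>n. wasserstein p (\<mu> \<star> \<eta>) (\<nu> n \<star> \<eta>) < ennreal (inverse (real (Suc n)))" "\<And>n. \<not> wasserstein p \<mu> (\<nu> n) < ennreal e"
    by metis
  have "(\<lambda>n. wasserstein p (\<nu> n \<star> \<eta>) (\<mu> \<star> \<eta>)) \<longlonglongrightarrow> 0"
  proof (rule tendsto_sandwich[OF _ _ tendsto_const])
    show "(\<lambda>n. ennreal (inverse (real (Suc n)))) \<longlonglongrightarrow> 0"
      using tendsto_ennrealI[OF LIMSEQ_inverse_real_of_nat] by simp
    show "\<forall>\<^sub>F n in sequentially. wasserstein p (\<nu> n \<star> \<eta>) (\<mu> \<star> \<eta>) \<le> ennreal (inverse (real (Suc n)))"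
      using less_imp_le[OF \<nu>(2)] by (simp add: wasserstein_commute)
  qed auto
  from wasserstein_tendsto_of_smoothed[OF p \<mu> \<nu>(1) \<eta> r this, of "e / 16"] e
  obtain n where n: "wasserstein p (\<nu> n) \<mu> \<le> ennreal (e / 2)"
    by (auto simp: eventually_sequentially)
  also have "\<dots> < ennreal e" using e by (simp add: ennreal_less_iff)
  finally show False using \<nu>(3)[of n] by (simp add: wasserstein_commute)
qed

section \<open>Metric and topology\<close>

lemma Metric_space_enn2real:
  assumes sym: "\<And>x y. D x y = D y x" and refl: "\<And>x. x \<in> M \<Longrightarrow> D x x = 0"
    and fin: "\<And>x y. x \<in> M \<Longrightarrow> y \<in> M \<Longrightarrow> D x y < \<top>"
    and zero: "\<And>x y. x \<in> M \<Longrightarrow> y \<in> M \<Longrightarrow> D x y = 0 \<Longrightarrow> x = y"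
    and triangle: "\<And>x y z. D x z \<le> D x y + D y z"
  shows "Metric_space M (\<lambda>x y. enn2real (D x y))"
proof
  show "enn2real (D x y) = enn2real (D y x)" for x y by (simp add: sym)
  show "(enn2real (D x y) = 0) = (x = y)" if "x \<in> M" "y \<in> M" for x y
    using that fin[of x y] zero[of x y] refl[of x] by (auto simp: enn2real_eq_0_iff)
  show "enn2real (D x z) \<le> enn2real (D x y) + enn2real (D y z)" if "x \<in> M" "y \<in> M" "z \<in> M" for x y z
  proof -
    have "enn2real (D x z) \<le> enn2real (D x y + D y z)"
      using that by (intro enn2real_mono triangle) (simp add: fin)
    then show ?thesis using that by (simp add: enn2real_plus fin)
  qed
qed simp

text \<open>The radius \<open>s\<close> may depend on the centre \<open>x\<close>: only balls around the same point are compared.\<close>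

lemma mtopology_eqI:
  assumes D: "Metric_space M d" and D': "Metric_space M d'"
    and 1: "\<And>x e. x \<in> M \<Longrightarrow> 0 < e \<Longrightarrow> \<exists>s>0. \<forall>y\<in>M. d x y < s \<longrightarrow> d' x y < e"
    and 2: "\<And>x e. x \<in> M \<Longrightarrow> 0 < e \<Longrightarrow> \<exists>s>0. \<forall>y\<in>M. d' x y < s \<longrightarrow> d x y < e"
  shows "Metric_space.mtopology M d = Metric_space.mtopology M d'"
proof -
  interpret A: Metric_space M d by fact
  interpret B: Metric_space M d' by fact
  show ?thesis
  proof (rule topology_eq[THEN iffD2], intro allI iffI)
    fix U assume "openin A.mtopology U"
    then have U: "U \<subseteq> M" "\<And>x. x \<in> U \<Longrightarrow> \<exists>r>0. A.mball x r \<subseteq> U" by (auto simp: A.openin_mtopology)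
    have "\<exists>r>0. B.mball x r \<subseteq> U" if x: "x \<in> U" for x
    proof -
      obtain r where r: "0 < r" "A.mball x r \<subseteq> U" using U(2)[OF x] by blast
      obtain s where "0 < s" "\<And>y. y \<in> M \<Longrightarrow> d' x y < s \<Longrightarrow> d x y < r" using 2[of x r] U(1) x r by blast
      then have "B.mball x s \<subseteq> A.mball x r" by (auto simp: A.in_mball B.in_mball)
      then show ?thesis using r \<open>0 < s\<close> by blast
    qed
    then show "openin B.mtopology U" using U(1) by (simp add: B.openin_mtopology)
  next
    fix U assume "openin B.mtopology U"
    then have U: "U \<subseteq> M" "\<And>x. x \<in> U \<Longrightarrow> \<exists>r>0. B.mball x r \<subseteq> U" by (auto simp: B.openin_mtopology)
    have "\<exists>r>0. A.mball x r \<subseteq> U" if x: "x \<in> U" for x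
    proof -
      obtain r where r: "0 < r" "B.mball x r \<subseteq> U" using U(2)[OF x] by blast
      obtain s where "0 < s" "\<And>y. y \<in> M \<Longrightarrow> d x y < s \<Longrightarrow> d' x y < r" using 1[of x r] U(1) x r by blast
      then have "A.mball x s \<subseteq> B.mball x r" by (auto simp: A.in_mball B.in_mball)
      then show ?thesis using r \<open>0 < s\<close> by blast
    qed
    then show "openin A.mtopology U" using U(1) by (simp add: A.openin_mtopology)
  qed
qed

theorem proposition5:
  fixes \<kappa> :: "real ^ 'n \<Rightarrow> real" and p \<sigma> :: real
  assumes "smoothing_kernel \<kappa>" and "1 \<le> p" and "0 < \<sigma>"
  shows "(\<forall>\<mu>\<in>finite_moment_measures p. \<forall>\<nu>\<in>finite_moment_measures p.
        smooth_wasserstein \<kappa> \<sigma> p \<mu> \<nu> < \<top>) \<and>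
    Metric_space (finite_moment_measures p)
      (\<lambda>\<mu> \<nu>. enn2real (smooth_wasserstein \<kappa> \<sigma> p \<mu> \<nu>)) \<and>
    Metric_space.mtopology (finite_moment_measures p)
      (\<lambda>\<mu> \<nu>. enn2real (smooth_wasserstein \<kappa> \<sigma> p \<mu> \<nu>)) =
    Metric_space.mtopology (finite_moment_measures p)
      (\<lambda>\<mu> \<nu>. enn2real (wasserstein p \<mu> \<nu>))"
proof -
  note p = \<open>1 \<le> p\<close>
  let ?P = "finite_moment_measures p :: (real ^ 'n) measure set"
  let ?\<eta> = "kernel_measure \<kappa> \<sigma>"
  let ?S = "smooth_wasserstein \<kappa> \<sigma> p" and ?W = "wasserstein p :: (real ^ 'n) measure \<Rightarrow> _"
  have \<eta>: "?\<eta> \<in> ?P" by (rule smoothing_kernel_properties(1)[OF assms(1,3) p])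
  obtain r where r: "0 \<le> r" "AE z in ?\<eta>. norm z \<le> r"
    using smoothing_kernel_properties(2)[OF assms(1,3) p] by blast
  have prob: "prob_space \<mu>" "sets \<mu> = sets borel" if "\<mu> \<in> ?P" for \<mu>
    using that finite_moment_measures_iff[OF p] by auto
  have S_fin: "?S \<mu> \<nu> < \<top>" if "\<mu> \<in> ?P" "\<nu> \<in> ?P" for \<mu> \<nu>
    unfolding smooth_wasserstein_def using that by (intro wasserstein_finite finite_moment_convolution p \<eta>)
  have W_fin: "?W \<mu> \<nu> < \<top>" if "\<mu> \<in> ?P" "\<nu> \<in> ?P" for \<mu> \<nu>
    using that by (intro wasserstein_finite p)
  have S_le: "?S \<mu> \<nu> \<le> ?W \<mu> \<nu>" for \<mu> \<nu>
    unfolding smooth_wasserstein_def by (intro wasserstein_convolution_le prob \<eta>)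
  have W_small: "\<exists>s>0. \<forall>\<nu>\<in>?P. ?S \<mu> \<nu> < ennreal s \<longrightarrow> ?W \<mu> \<nu> < ennreal e" if "\<mu> \<in> ?P" "0 < e" for \<mu> e
    using wasserstein_small_of_smoothed_small[OF p that(1) \<eta> r that(2)] unfolding smooth_wasserstein_def by metis
  have W_eq: "\<mu> = \<nu>" if "\<mu> \<in> ?P" "\<nu> \<in> ?P" "?W \<mu> \<nu> = 0" for \<mu> \<nu>
    using that by (intro wasserstein_eq_0_imp_eq[OF p] prob)
  \<comment> \<open>Smoothed distance zero is below every threshold of \<open>W_small\<close>.\<close>
  have S_eq: "\<mu> = \<nu>" if "\<mu> \<in> ?P" "\<nu> \<in> ?P" "?S \<mu> \<nu> = 0" for \<mu> \<nu>
  proof (rule W_eq)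
    have "?W \<mu> \<nu> < ennreal e" if "0 < e" for e
      using W_small[OF \<open>\<mu> \<in> ?P\<close> that] \<open>\<nu> \<in> ?P\<close> \<open>?S \<mu> \<nu> = 0\<close> by auto
    then have "?W \<mu> \<nu> \<le> 0 + ennreal e" if "0 < e" for e
      using that by (simp add: less_imp_le)
    then have "?W \<mu> \<nu> \<le> 0" by (rule ennreal_le_epsilon)
    then show "?W \<mu> \<nu> = 0" by simp
  qed fact+
  have S_metric: "Metric_space ?P (\<lambda>\<mu> \<nu>. enn2real (?S \<mu> \<nu>))"
  proof (rule Metric_space_enn2real)
    show "?S \<mu> \<nu> = ?S \<nu> \<mu>" for \<mu> \<nu> unfolding smooth_wasserstein_def by (rule wasserstein_commute)
    show "?S \<mu> \<mu> = 0" if "\<mu> \<in> ?P" for \<mu>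
      unfolding smooth_wasserstein_def using that by (intro wasserstein_refl prob finite_moment_convolution p \<eta>)
    show "?S \<mu>1 \<mu>3 \<le> ?S \<mu>1 \<mu>2 + ?S \<mu>2 \<mu>3" for \<mu>1 \<mu>2 \<mu>3
      unfolding smooth_wasserstein_def by (rule wasserstein_triangle[OF p])
  qed (fact S_fin S_eq)+
  have W_metric: "Metric_space ?P (\<lambda>\<mu> \<nu>. enn2real (?W \<mu> \<nu>))"
  proof (rule Metric_space_enn2real)
    show "?W \<mu> \<nu> = ?W \<nu> \<mu>" for \<mu> \<nu> by (rule wasserstein_commute)
    show "?W \<mu> \<mu> = 0" if "\<mu> \<in> ?P" for \<mu> using that by (intro wasserstein_refl prob)
    show "?W \<mu>1 \<mu>3 \<le> ?W \<mu>1 \<mu>2 + ?W \<mu>2 \<mu>3" for \<mu>1 \<mu>2 \<mu>3 by (rule wasserstein_triangle[OF p])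
  qed (fact W_fin W_eq)+
  have less_iff: "enn2real x < e \<longleftrightarrow> x < ennreal e" if "x < \<top>" "0 < e" for x e
    using that by (cases x) (auto simp: ennreal_less_iff)
  have "Metric_space.mtopology ?P (\<lambda>\<mu> \<nu>. enn2real (?S \<mu> \<nu>)) = Metric_space.mtopology ?P (\<lambda>\<mu> \<nu>. enn2real (?W \<mu> \<nu>))"
  proof (rule mtopology_eqI[OF S_metric W_metric])
    fix \<mu> and e :: real assume \<mu>: "\<mu> \<in> ?P" and e: "0 < e"
    obtain s where s: "0 < s" "\<forall>\<nu>\<in>?P. ?S \<mu> \<nu> < ennreal s \<longrightarrow> ?W \<mu> \<nu> < ennreal e"
      using W_small[OF \<mu> e] by blast
    then show "\<exists>s>0. \<forall>\<nu>\<in>?P. enn2real (?S \<mu> \<nu>) < s \<longrightarrow> enn2real (?W \<mu> \<nu>) < e"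
      using \<mu> e by (intro exI[of _ s]) (auto simp: less_iff S_fin W_fin)
    show "\<exists>s>0. \<forall>\<nu>\<in>?P. enn2real (?W \<mu> \<nu>) < s \<longrightarrow> enn2real (?S \<mu> \<nu>) < e"
      using \<mu> e S_le by (intro exI[of _ e]) (auto simp: less_iff S_fin W_fin intro: le_less_trans)
  qed
  then show ?thesis using S_fin S_metric by blast
qed

end
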